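(* Let $t\le 1$ and $L_2\neq0$. Let $\mathbf Q$ be a non-trivial uniaxial solution of the anisotropic Euler–Lagrange equations $$\Delta \mathbf{Q}_{ij} + \frac{L_2}{2}\Bigl(\mathbf{Q}_{ik,kj} + \mathbf{Q}_{jk,ki} - \tfrac23\delta_{ij}\mathbf{Q}_{kl,kl}\Bigr) = t\,\mathbf{Q}_{ij} - 3\sqrt6\Bigl(\mathbf{Q}_{ik}\mathbf{Q}_{kj} - \tfrac13\delta_{ij}\,\mathrm{tr}(\mathbf{Q}^2)\Bigr) + 2\,\mathbf{Q}_{ij}\,\mathrm{tr}(\mathbf{Q}^2),\qquad i,j=1,2,3,$$ in $\mathbb R^3$, of the form $$\mathbf{Q}(r,\theta,\varphi) = s(r)\Bigl(\mathbf n(\theta,\varphi)\otimes\mathbf n(\theta,\varphi) - \tfrac13\mathbf I\Bigr).$$ Then, with directors identified up to sign, $$\mathbf n(\theta,\varphi) = \frac{\mathbf x}{|\mathbf x|},$$ and $s$ is a solution of $$\Bigl(1+\tfrac23L_2\Bigr)\Bigl(s''(r)+\frac2r s'(r)\Bigr) = \Bigl(1+\tfrac23L_2\Bigr)\frac{6}{r^2}s(r) + \psi(s(r)),\qquad \psi(s) = ts-\sqrt6\,s^2+\frac43s^3 .$$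
   Context: Spherical polar coordinates: $\mathbf x = (r\cos\theta\sin\varphi,\ r\sin\theta\sin\varphi,\ r\cos\varphi)$ with $0\le r<\infty$, $0\le\varphi\le\pi$, $0\le\theta<2\pi$. Here $\mathbf Q$ takes values in symmetric traceless real $3\times3$ matrices, repeated indices are summed, indices after a comma denote partial derivatives with respect to Cartesian coordinates, $\mathbf I$ is the $3\times3$ identity, and solutions are classical. A uniaxial solution is a solution of the form $\mathbf Q = s(\mathbf n\otimes\mathbf n-\frac13\mathbf I)$ with a real-valued scalar order parameter $s$ and a unit-vector field $\mathbf n$ (the director). It is called trivial if the director is constant on every connected component of the region $\{\mathbf Q\ne0\}$ (in particular if $\mathbf Q\equiv0$), and non-trivial otherwise. Since $\mathbf n$ and $-\mathbf n$ give the same $\mathbf Q$, directors are identified up to sign. The real number $t$ is the reduced temperature and $L_2$ the elastic anisotropy parameter. *)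

theory Defs
  imports "HOL-Analysis.Analysis"
begin

definition spherical :: "real \<Rightarrow> real \<Rightarrow> real \<Rightarrow> real^3" where
  "spherical r \<theta> \<phi> = vector [r * cos \<theta> * sin \<phi>, r * sin \<theta> * sin \<phi>, r * cos \<phi>]"

definition outer :: "real^3 \<Rightarrow> real^3 \<Rightarrow> real^3^3" where
  "outer u v = (\<chi> i j. u $ i * v $ j)"

definition uniaxial_tensor :: "real \<Rightarrow> real^3 \<Rightarrow> real^3^3" where
  "uniaxial_tensor s m = s *\<^sub>R (outer m m - (1/3) *\<^sub>R mat 1)"

definition partial :: "3 \<Rightarrow> (real^3 \<Rightarrow> real) \<Rightarrow> real^3 \<Rightarrow> real" where
  "partial k f x = frechet_derivative f (at x) (axis k 1)"

definition C2 :: "(real^3 \<Rightarrow> real) \<Rightarrow> bool" where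
  "C2 f \<longleftrightarrow>
     (\<forall>x. f differentiable at x) \<and>
     (\<forall>k x. partial k f differentiable at x) \<and>
     (\<forall>k l. continuous_on UNIV (partial l (partial k f)))"

text \<open>\<open>D2 Q i j k l x\<close> is \<open>Q\<close> with indices \<open>ij,kl\<close>, evaluated at \<open>x\<close>.\<close>

definition D2 :: "(real^3 \<Rightarrow> real^3^3) \<Rightarrow> 3 \<Rightarrow> 3 \<Rightarrow> 3 \<Rightarrow> 3 \<Rightarrow> real^3 \<Rightarrow> real" where
  "D2 Q i j k l = partial l (partial k (\<lambda>x. Q x $ i $ j))"

text \<open>The Kronecker delta is written as the entry \<open>mat 1 $ i $ j\<close> of the identity matrix.\<close>

definition Euler_Lagrange_solution :: "real \<Rightarrow> real \<Rightarrow> (real^3 \<Rightarrow> real^3^3) \<Rightarrow> bool" where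
  "Euler_Lagrange_solution t L\<^sub>2 Q \<longleftrightarrow>
     (\<forall>x. transpose (Q x) = Q x \<and> trace (Q x) = 0) \<and>
     (\<forall>i j. C2 (\<lambda>x. Q x $ i $ j)) \<and>
     (\<forall>x i j.
        (\<Sum>k\<in>UNIV. D2 Q i j k k x)
        + L\<^sub>2 / 2 * ((\<Sum>k\<in>UNIV. D2 Q i k k j x) + (\<Sum>k\<in>UNIV. D2 Q j k k i x)
            - 2/3 * mat 1 $ i $ j * (\<Sum>k\<in>UNIV. \<Sum>l\<in>UNIV. D2 Q k l k l x))
        = t * Q x $ i $ j
          - 3 * sqrt 6 * ((\<Sum>k\<in>UNIV. Q x $ i $ k * Q x $ k $ j)
              - 1/3 * mat 1 $ i $ j * trace (Q x ** Q x))
          + 2 * Q x $ i $ j * trace (Q x ** Q x))"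

definition uniaxial :: "(real^3 \<Rightarrow> real^3^3) \<Rightarrow> bool" where
  "uniaxial Q \<longleftrightarrow>
     (\<exists>(s :: real^3 \<Rightarrow> real) (n :: real^3 \<Rightarrow> real^3). \<forall>x. norm (n x) = 1 \<and> Q x = uniaxial_tensor (s x) (n x))"

text \<open>A nonzero uniaxial tensor has exactly two directors, which differ by a sign. A director
  field that is constant up to sign is therefore one for which a single vector \<open>m\<close> is a
  director at every point.\<close>

definition is_director :: "real^3 \<Rightarrow> real^3^3 \<Rightarrow> bool" where
  "is_director m A \<longleftrightarrow> norm m = 1 \<and> (\<exists>s. A = uniaxial_tensor s m)"

definition trivial :: "(real^3 \<Rightarrow> real^3^3) \<Rightarrow> bool" where
  "trivial Q \<longleftrightarrow> (\<forall>C \<in> components {x. Q x \<noteq> 0}. \<exists>m. \<forall>x\<in>C. is_director m (Q x))"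

definition \<psi> :: "real \<Rightarrow> real \<Rightarrow> real" where
  "\<psi> t s = t * s - sqrt 6 * s\<^sup>2 + 4/3 * s ^ 3"

text \<open>Classical solutions of the radial equation. The coefficients are singular at the origin, so
  the equation is posed for \<open>r > 0\<close>.\<close>

definition radial_solution :: "real \<Rightarrow> real \<Rightarrow> (real \<Rightarrow> real) \<Rightarrow> bool" where
  "radial_solution t L\<^sub>2 s \<longleftrightarrow>
     (\<forall>r>0. s differentiable at r) \<and>
     (\<forall>r>0. deriv s differentiable at r) \<and>
     continuous_on {0<..} (deriv (deriv s)) \<and>
     (\<forall>r>0. (1 + 2/3 * L\<^sub>2) * (deriv (deriv s) r + 2 / r * deriv s r)
        = (1 + 2/3 * L\<^sub>2) * (6 / r\<^sup>2) * s r + \<psi> t (s r))"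

end

theory Submission
  imports Defs
begin

text \<open>
  Write \<open>Q x = s |x| * A x\<close>, where \<open>A\<close> is homogeneous of degree \<open>0\<close> and equals
  \<open>n \<otimes> n - I/3\<close> on the unit sphere. Evaluating \<open>Q\<close> at the origin along different rays shows that
  \<open>s 0 \<noteq> 0\<close> would force \<open>A\<close> to be constant, that is \<open>Q\<close> to be trivial; so \<open>s 0 = 0\<close> while \<open>s\<close>
  does not vanish identically. Dividing \<open>Q\<close> on one sphere by a nonzero value of \<open>s\<close> exhibits \<open>A\<close> as
  a tensor field that is twice differentiable away from the origin, and one nonzero entry of \<open>A\<close>
  exhibits \<open>s\<close> as a \<open>C\<^sup>2\<close> function up to \<open>r = 0\<close>.

  Fix a unit vector \<open>\<omega>\<close>. By homogeneity the equations along the ray through \<open>\<omega>\<close> take the form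
  \<open>r\<^sup>2 s'' E0 + r s' E1 + s E2 = r\<^sup>2 \<psi>(s) A(\<omega>)\<close> with tensors \<open>E0, E1, E2\<close> that do not depend on
  \<open>r\<close> (\<open>Euler_Lagrange_on_ray\<close>). The leading tensor \<open>E0\<close> is \<open>A(\<omega>)\<close> plus \<open>L/2\<close> times an
  anisotropic part that contains \<open>\<omega> \<otimes> \<omega>\<close>. If \<open>n(\<omega>)\<close> is not parallel to \<open>\<omega>\<close>, then \<open>E0\<close> is not a
  multiple of \<open>A(\<omega>)\<close>: the biaxial component of the equations, on which the right-hand side
  vanishes, is a homogeneous Euler equation \<open>r\<^sup>2 s'' + b r s' + c s = 0\<close> with nonzero leading
  coefficient (\<open>oblique_functional\<close>). Eliminating \<open>s''\<close> from the component along \<open>n \<otimes> n\<close> leaves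
  \<open>r\<^sup>2 \<psi>(s) = p r s' + q s\<close>.

  These two equations are incompatible unless \<open>s = 0\<close> (\<open>scale_invariant_ODE_zero\<close>). In the
  variable \<open>\<tau> = ln r\<close> the first one has constant coefficients, and \<open>s\<close> and \<open>ds/d\<tau>\<close> tend to \<open>0\<close> as
  \<open>\<tau> \<rightarrow> -\<infinity>\<close>; for a nonzero solution this implies that \<open>|s| + |ds/d\<tau>|\<close> tends to infinity as
  \<open>\<tau> \<rightarrow> \<infinity>\<close>. But \<open>\<psi>\<close> is cubic, so the second one then gives \<open>|s|\<^sup>3 \<le> K |ds/d\<tau>|\<close> for large
  \<open>\<tau>\<close>, which means blow-up in finite time. Hence \<open>n(\<omega>) = \<plusminus>\<omega>\<close> for every \<open>\<omega>\<close>
  (\<open>director_radial\<close>). The radial equation is then one entry of the equations for the explicit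
  field \<open>A x = x \<otimes> x / |x|\<^sup>2 - I/3\<close> (\<open>hedgehog_radial_equation\<close>).
\<close>

section \<open>Partial derivatives of radial products\<close>

lemma sum_mult_axis: "(\<Sum>m\<in>UNIV. g m * axis k (1::real) $ m) = g k"
  by (simp add: axis_def if_distrib sum.delta' cong: if_cong)

lemma partial_eqI:
  assumes "(f has_derivative f') (at x)"
  shows "partial k f x = f' (axis k 1)"
  using frechet_derivative_at[OF assms] by (simp add: partial_def)

lemma has_derivative_partial:
  fixes f :: "real^3 \<Rightarrow> real"
  assumes "f differentiable at x"
  shows "(f has_derivative (\<lambda>h. \<Sum>k\<in>UNIV. partial k f x * h $ k)) (at x)"
proof -
  let ?D = "frechet_derivative f (at x)"
  have D: "(f has_derivative ?D) (at x)"
    using assms by (simp add: frechet_derivative_works)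
  then have lin: "linear ?D"
    using has_derivative_bounded_linear bounded_linear.linear by blast
  have "?D = (\<lambda>h. \<Sum>k\<in>UNIV. partial k f x * h $ k)"
  proof
    fix h :: "real^3"
    have "?D h = ?D (\<Sum>k\<in>UNIV. h $ k *\<^sub>R axis k 1)"
      using basis_expansion[of h] by (simp add: scalar_mult_eq_scaleR)
    also have "\<dots> = (\<Sum>k\<in>UNIV. h $ k *\<^sub>R ?D (axis k 1))"
      by (simp add: linear_sum[OF lin] linear_scale[OF lin])
    finally show "?D h = (\<Sum>k\<in>UNIV. partial k f x * h $ k)"
      by (simp add: partial_def mult.commute)
  qed
  with D show ?thesis by simp
qed

lemma partial_transform_within_open:
  assumes "open S" "x \<in> S" "\<And>y. y \<in> S \<Longrightarrow> f y = g y"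
  shows "partial k f x = partial k g x"
proof -
  have "(f has_derivative D) (at x) \<longleftrightarrow> (g has_derivative D) (at x)" for D
    using has_derivative_transform_within_open[of f D x UNIV S g]
      has_derivative_transform_within_open[of g D x UNIV S f] assms by auto
  then show ?thesis by (simp add: partial_def frechet_derivative_def)
qed

lemma partial_scale:
  assumes "g differentiable at (c *\<^sub>R x)"
  shows "((\<lambda>x. g (c *\<^sub>R x)) has_derivative (\<lambda>h. \<Sum>k\<in>UNIV. partial k g (c *\<^sub>R x) * (c * h $ k))) (at x)"
    and "partial k (\<lambda>x. g (c *\<^sub>R x)) x = c * partial k g (c *\<^sub>R x)"
proof -
  have "((\<lambda>x. c *\<^sub>R x) has_derivative (\<lambda>h. c *\<^sub>R h)) (at x)"
    by (auto intro!: derivative_eq_intros)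
  from diff_chain_at[OF this has_derivative_partial[OF assms]]
  show d: "((\<lambda>x. g (c *\<^sub>R x)) has_derivative (\<lambda>h. \<Sum>k\<in>UNIV. partial k g (c *\<^sub>R x) * (c * h $ k))) (at x)"
    by (simp add: o_def)
  show "partial k (\<lambda>x. g (c *\<^sub>R x)) x = c * partial k g (c *\<^sub>R x)"
    using partial_eqI[OF d, of k] sum_mult_axis[of "\<lambda>m. partial m g (c *\<^sub>R x) * c" k]
    by (simp add: mult_ac)
qed

lemma radial_has_derivative:
  fixes x :: "real^3"
  assumes "x \<noteq> 0" "(f has_real_derivative f') (at (norm x))"
  shows "((\<lambda>x. f (norm x)) has_derivative (\<lambda>h. f' * (x \<bullet> h / norm x))) (at x)"
proof -
  have "(norm has_derivative (\<lambda>h. x \<bullet> h / norm x)) (at x)"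
    using has_derivative_norm[OF assms(1)] by (simp add: sgn_div_norm inner_commute field_simps)
  moreover have "(f has_derivative (\<lambda>h. f' * h)) (at (norm x))"
    using assms(2) by (simp add: has_field_derivative_def)
  ultimately show ?thesis
    using diff_chain_at by (force simp: o_def)
qed

lemma partial_radial_product:
  fixes x :: "real^3" and B :: "real^3 \<Rightarrow> real"
  assumes "x \<noteq> 0" "(f has_real_derivative f') (at (norm x))" "B differentiable at x"
  shows "partial k (\<lambda>x. f (norm x) * B x) x
    = f' * (x $ k / norm x) * B x + f (norm x) * partial k B x"
proof -
  have "((\<lambda>x. f (norm x) * B x) has_derivative
     (\<lambda>h. f (norm x) * (\<Sum>k\<in>UNIV. partial k B x * h $ k) + f' * (x \<bullet> h / norm x) * B x)) (at x)"
    by (rule has_derivative_mult[OF radial_has_derivative[OF assms(1,2)] has_derivative_partial[OF assms(3)]])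
  from partial_eqI[OF this, of k] show ?thesis
    by (simp add: inner_axis sum_mult_axis)
qed

lemma has_derivative_coordinate_over_norm:
  fixes x :: "real^3"
  assumes "x \<noteq> 0"
  shows "((\<lambda>x. x $ k / norm x) has_derivative
      (\<lambda>h. h $ k / norm x - x $ k * (x \<bullet> h) / norm x ^ 3)) (at x)"
proof -
  have n: "(norm has_derivative (\<lambda>h. x \<bullet> h / norm x)) (at x)"
    using has_derivative_norm[OF assms(1)] by (simp add: sgn_div_norm inner_commute field_simps)
  have c: "((\<lambda>x::real^3. x $ k) has_derivative (\<lambda>h. h $ k)) (at x)"
    by (rule bounded_linear_imp_has_derivative[OF bounded_linear_vec_nth])
  have "((\<lambda>x. x $ k / norm x) has_derivative
     (\<lambda>h. - x $ k * (inverse (norm x) * (x \<bullet> h / norm x) * inverse (norm x)) + h $ k / norm x)) (at x)"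
    by (rule has_derivative_divide[OF c n]) (use assms in simp)
  then show ?thesis
    by (rule has_derivative_eq_rhs) (use assms in \<open>simp add: fun_eq_iff field_simps power3_eq_cube\<close>)
qed

text \<open>The case \<open>B = A_ij\<close> is an entry of the separated tensor field. Regularity of \<open>f\<close> is required
  on the open half-line and of \<open>B\<close> off the origin only, because the direction field of a hedgehog
  is discontinuous at the origin.\<close>

lemma partial_partial_radial_product:
  fixes x :: "real^3" and B :: "real^3 \<Rightarrow> real"
  assumes x: "x \<noteq> 0"
    and f1: "\<And>r. r > 0 \<Longrightarrow> (f has_real_derivative f' r) (at r)"
    and f2: "\<And>r. r > 0 \<Longrightarrow> (f' has_real_derivative f'' r) (at r)"
    and B1: "\<And>x. x \<noteq> 0 \<Longrightarrow> B differentiable at x"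
    and B2: "\<And>x. x \<noteq> 0 \<Longrightarrow> partial k B differentiable at x"
  shows "partial l (partial k (\<lambda>x. f (norm x) * B x)) x
    = f'' (norm x) * (x $ k * x $ l / norm x ^ 2) * B x
      + f' (norm x) * ((axis k 1 $ l / norm x - x $ k * x $ l / norm x ^ 3) * B x
          + x $ k / norm x * partial l B x + x $ l / norm x * partial k B x)
      + f (norm x) * partial l (partial k B) x"
proof -
  have nx: "norm x > 0" using x by simp
  let ?g = "\<lambda>x. f' (norm x) * (x $ k / norm x * B x) + f (norm x) * partial k B x"
  have "partial l (partial k (\<lambda>x. f (norm x) * B x)) x = partial l ?g x"
    by (rule partial_transform_within_open[of "-{0}"])
       (use x partial_radial_product[OF _ f1 B1] in \<open>auto simp: mult.assoc\<close>)
  also have "\<dots> = f'' (norm x) * (x $ l / norm x) * (x $ k / norm x * B x)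
      + f' (norm x) * (x $ k / norm x * partial l B x + (axis l 1 $ k / norm x - x $ k * (x $ l) / norm x ^ 3) * B x)
      + (f' (norm x) * (x $ l / norm x) * partial k B x + f (norm x) * partial l (partial k B) x)"
  proof -
    have c: "((\<lambda>x. x $ k / norm x * B x) has_derivative
       (\<lambda>h. x $ k / norm x * (\<Sum>k\<in>UNIV. partial k B x * h $ k)
         + (h $ k / norm x - x $ k * (x \<bullet> h) / norm x ^ 3) * B x)) (at x)"
      by (rule has_derivative_mult[OF has_derivative_coordinate_over_norm[OF x] has_derivative_partial[OF B1[OF x]]])
    note a = has_derivative_mult[OF radial_has_derivative[OF x f2[OF nx]] c]
    note b = has_derivative_mult[OF radial_has_derivative[OF x f1[OF nx]] has_derivative_partial[OF B2[OF x]]]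
    show ?thesis
      using partial_eqI[OF has_derivative_add[OF a b], of l]
      by (simp add: inner_axis sum_mult_axis)
  qed
  also have "axis l (1::real) $ k = axis k 1 $ l" by (simp add: axis_def)
  finally show ?thesis by (simp add: algebra_simps power2_eq_square)
qed

definition twice_differentiable_off_0 :: "(real^3 \<Rightarrow> real) \<Rightarrow> bool" where
  "twice_differentiable_off_0 B \<longleftrightarrow>
     (\<forall>x. x \<noteq> 0 \<longrightarrow> B differentiable at x \<and> (\<forall>k. partial k B differentiable at x))"

text \<open>This is how the angular factor inherits regularity from \<open>Q\<close>: it is the degree-\<open>0\<close> extension of
  the values of \<open>Q\<close> on a single sphere, divided by the value of \<open>s\<close> there.\<close>

lemma C2_radial_extension:
  fixes g :: "real^3 \<Rightarrow> real"
  assumes "C2 g"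
  shows "twice_differentiable_off_0 (\<lambda>x. a * g (\<rho> *\<^sub>R (x /\<^sub>R norm x)))"
proof -
  define B where "B = (\<lambda>x. a * g (\<rho> *\<^sub>R (x /\<^sub>R norm x)))"
  define p where "p = (\<lambda>x::real^3. \<rho> *\<^sub>R (x /\<^sub>R norm x))"
  have p: "(p has_derivative (\<lambda>h. \<chi> m. \<rho> * (h $ m / norm x - x $ m * (x \<bullet> h) / norm x ^ 3))) (at x)"
    if "x \<noteq> 0" for x
  proof (rule has_derivative_componentwise_within[THEN iffD2], rule ballI)
    fix b :: "real^3" assume "b \<in> Basis"
    then obtain m where m: "b = axis m 1" by (auto simp: Basis_vec_def)
    have "((\<lambda>x. \<rho> * (x $ m / norm x)) has_derivative
        (\<lambda>h. \<rho> * (h $ m / norm x - x $ m * (x \<bullet> h) / norm x ^ 3))) (at x)"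
      by (rule has_derivative_mult_right[OF has_derivative_coordinate_over_norm[OF that]])
    then show "((\<lambda>x. p x \<bullet> b) has_derivative
        (\<lambda>h. (\<chi> m. \<rho> * (h $ m / norm x - x $ m * (x \<bullet> h) / norm x ^ 3)) \<bullet> b)) (at x)"
      by (simp add: m inner_axis p_def divide_inverse mult_ac)
  qed
  have g1: "g differentiable at y" and g2: "partial m g differentiable at y" for y m
    using assms by (auto simp: C2_def)
  have B: "B = (\<lambda>x. a * g (p x))" by (simp add: B_def p_def)
  have B1: "(B has_derivative (\<lambda>h. a * (\<Sum>m\<in>UNIV. partial m g (p x) *
      (\<rho> * (h $ m / norm x - x $ m * (x \<bullet> h) / norm x ^ 3))))) (at x)" if "x \<noteq> 0" for x
    using has_derivative_mult_right[OF diff_chain_at[OF p[OF that] has_derivative_partial[OF g1]], of a] by (simp add: o_def B)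
  have d1: "B differentiable at x" if "x \<noteq> 0" for x
    using B1[OF that] by (auto simp: differentiable_def)
  let ?h = "\<lambda>k x. a * (\<Sum>m\<in>UNIV. partial m g (p x) *
      (\<rho> * (axis k 1 $ m * (1 / norm x) - x $ m / norm x * (x $ k / norm x) * (1 / norm x))))"
  have eq: "partial k B x = ?h k x" if "x \<noteq> 0" for x k
    unfolding partial_eqI[OF B1[OF that]]
    by (simp add: inner_axis power3_eq_cube)
  have d2: "partial k B differentiable at x" if "x \<noteq> 0" for x k
  proof -
    have "p differentiable at x" using p[OF that] by (auto simp: differentiable_def)
    then have gp: "(\<lambda>x. partial m g (p x)) differentiable at x" for m
      using differentiable_chain_at[OF _ g2] by (force simp: o_def)
    have cd: "(\<lambda>x. x $ m / norm x) differentiable at x" for m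
      using has_derivative_coordinate_over_norm[OF that] by (auto simp: differentiable_def)
    have nd: "(\<lambda>x. 1 / norm x) differentiable at x"
      using differentiable_norm_at[OF that] that
      by (intro differentiable_divide) auto
    have "?h k differentiable at x"
      by (intro differentiable_sum ballI differentiable_mult differentiable_diff differentiable_const gp cd nd) simp_all
    then obtain D where "(?h k has_derivative D) (at x)" by (auto simp: differentiable_def)
    then have "(partial k B has_derivative D) (at x)"
      by (rule has_derivative_transform_within_open[of _ _ _ _ "-{0}"]) (use that eq in auto)
    then show ?thesis by (auto simp: differentiable_def)
  qed
  show ?thesis
    using d1 d2 by (simp add: twice_differentiable_off_0_def B_def)
qed

text \<open>Since the director is constant along a ray, \<open>s\<close> is a constant multiple of the
  restriction of an entry of \<open>Q\<close> to a ray on which that entry is not identically zero. The formulas extend to negative \<open>r\<close>, which gives the regularity of \<open>s\<close> up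
  to \<open>r = 0\<close>.\<close>

lemma C2_ray_derivatives:
  fixes g :: "real^3 \<Rightarrow> real" and \<omega> :: "real^3"
  assumes "C2 g"
  defines "g1 \<equiv> \<lambda>r. \<Sum>k\<in>UNIV. partial k g (r *\<^sub>R \<omega>) * \<omega> $ k"
    and "g2 \<equiv> \<lambda>r. \<Sum>k\<in>UNIV. (\<Sum>l\<in>UNIV. partial l (partial k g) (r *\<^sub>R \<omega>) * \<omega> $ l) * \<omega> $ k"
  shows "((\<lambda>r. g (r *\<^sub>R \<omega>)) has_real_derivative g1 r) (at r)"
    and "(g1 has_real_derivative g2 r) (at r)"
    and "continuous_on UNIV g2"
proof -
  have line: "((\<lambda>r. r *\<^sub>R \<omega>) has_derivative (\<lambda>h. h *\<^sub>R \<omega>)) (at r)" for r :: real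
    by (auto intro!: derivative_eq_intros)
  have *: "((\<lambda>r. f (r *\<^sub>R \<omega>)) has_real_derivative (\<Sum>k\<in>UNIV. partial k f (r *\<^sub>R \<omega>) * \<omega> $ k)) (at r)"
    if "\<And>x. f differentiable at x" for f :: "real^3 \<Rightarrow> real" and r :: real
  proof -
    have "((\<lambda>r. f (r *\<^sub>R \<omega>)) has_derivative (\<lambda>h. \<Sum>k\<in>UNIV. partial k f (r *\<^sub>R \<omega>) * (h *\<^sub>R \<omega>) $ k)) (at r)"
      using diff_chain_at[OF line has_derivative_partial[OF that]] by (simp add: o_def)
    moreover have "(\<lambda>h. \<Sum>k\<in>UNIV. partial k f (r *\<^sub>R \<omega>) * (h *\<^sub>R \<omega>) $ k)
        = (*) (\<Sum>k\<in>UNIV. partial k f (r *\<^sub>R \<omega>) * \<omega> $ k)"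
      by (simp add: fun_eq_iff sum_distrib_left mult_ac)
    ultimately show ?thesis by (simp add: has_field_derivative_def)
  qed
  show "((\<lambda>r. g (r *\<^sub>R \<omega>)) has_real_derivative g1 r) (at r)"
    unfolding g1_def using assms(1) by (intro *) (simp add: C2_def)
  show "(g1 has_real_derivative g2 r) (at r)"
    unfolding g1_def g2_def using assms(1)
    by (intro DERIV_sum DERIV_cmult_right *) (simp add: C2_def)
  have "continuous_on UNIV (\<lambda>r::real. partial l (partial k g) (r *\<^sub>R \<omega>))" for l k
    by (rule continuous_on_compose2[of UNIV "partial l (partial k g)"])
       (use assms(1) in \<open>auto simp: C2_def intro!: continuous_intros\<close>)
  then show "continuous_on UNIV g2"
    unfolding g2_def by (intro continuous_intros) auto
qed

section \<open>Scale-invariant radial equations\<close>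

text \<open>With \<open>\<mu>, \<nu>\<close> the complex characteristic roots, \<open>u = w' - \<mu> w\<close> satisfies \<open>u' = \<nu> u\<close>, so
  \<open>u\<close> is a multiple of \<open>exp (\<nu> \<tau>)\<close>; as it tends to \<open>0\<close> at \<open>-\<infinity>\<close>, it is zero or
  \<open>\<nu>\<close> has positive real part and \<open>u\<close> grows exponentially. If \<open>u\<close> is zero, the same
  alternative for \<open>w' = \<mu> w\<close> settles the claim. Complex roots need no separate treatment.\<close>

lemma const_coeff_ODE_unbounded:
  fixes w w' :: "real \<Rightarrow> real" and b c :: real
  assumes dw: "\<And>\<tau>. (w has_real_derivative w' \<tau>) (at \<tau>)"
    and dw': "\<And>\<tau>. (w' has_real_derivative - b * w' \<tau> - c * w \<tau>) (at \<tau>)"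
    and lim: "(w \<longlongrightarrow> 0) at_bot" "(w' \<longlongrightarrow> 0) at_bot"
    and nz: "w \<tau>0 \<noteq> 0"
  shows "filterlim (\<lambda>\<tau>. \<bar>w \<tau>\<bar> + \<bar>w' \<tau>\<bar>) at_top at_top"
proof -
  have "\<exists>\<mu> \<nu> :: complex. \<mu> + \<nu> = - of_real b \<and> \<mu> * \<nu> = of_real c"
  proof -
    define D where "D = csqrt (of_real (b\<^sup>2 - 4 * c))"
    have D: "D * D = of_real (b\<^sup>2 - 4 * c)"
      unfolding D_def by (metis power2_csqrt power2_eq_square)
    have "(- of_real b + D) / 2 * ((- of_real b - D) / 2) = (of_real b * of_real b - D * D) / 4"
      by (simp add: algebra_simps)
    also have "\<dots> = of_real c" unfolding D by (simp add: power2_eq_square)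
    finally have "(- of_real b + D) / 2 * ((- of_real b - D) / 2) = of_real c" .
    moreover have "(- of_real b + D) / 2 + (- of_real b - D) / 2 = - of_real b"
      by (simp add: add_divide_distrib[symmetric])
    ultimately show ?thesis by blast
  qed
  then obtain \<mu> \<nu> :: complex where sum: "\<mu> + \<nu> = - of_real b" and prod: "\<mu> * \<nu> = of_real c"
    by blast
  have growth: "u = (\<lambda>_. 0) \<or> filterlim (\<lambda>\<tau>. \<bar>w \<tau>\<bar> + \<bar>w' \<tau>\<bar>) at_top at_top"
    if du: "\<And>\<tau>. (u has_vector_derivative \<kappa> * u \<tau>) (at \<tau>)"
      and u: "u = (\<lambda>\<tau>. of_real (w' \<tau>) * \<alpha> + of_real (w \<tau>) * \<beta>)" for u :: "real \<Rightarrow> complex" and \<kappa> \<alpha> \<beta>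
  proof -
    have "((\<lambda>\<tau>. u \<tau> * exp (- of_real \<tau> * \<kappa>)) has_vector_derivative 0) (at \<tau>)" for \<tau>
    proof -
      have "((\<lambda>z. exp (- z * \<kappa>)) has_field_derivative - \<kappa> * exp (- of_real \<tau> * \<kappa>)) (at (of_real \<tau>))"
        by (auto intro!: derivative_eq_intros)
      then have "((\<lambda>\<tau>. exp (- of_real \<tau> * \<kappa>)) has_vector_derivative - \<kappa> * exp (- of_real \<tau> * \<kappa>)) (at \<tau>)"
        by (rule has_vector_derivative_real_field)
      from has_vector_derivative_mult[OF du this] show ?thesis
        by (simp only: mult_minus_left mult_minus_right mult.assoc mult.left_commute[of \<kappa>] left_minus right_minus)
    qed
    then obtain K where K: "\<And>\<tau>. u \<tau> * exp (- of_real \<tau> * \<kappa>) = K"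
      using has_vector_derivative_zero_constant[of UNIV "\<lambda>\<tau>. u \<tau> * exp (- of_real \<tau> * \<kappa>)"] by auto
    have ue: "u \<tau> = K * exp (of_real \<tau> * \<kappa>)" for \<tau>
    proof -
      have "u \<tau> = u \<tau> * exp (- of_real \<tau> * \<kappa>) * exp (of_real \<tau> * \<kappa>)"
        by (simp add: mult.assoc exp_add[symmetric])
      then show ?thesis unfolding K .
    qed
    have nu: "norm (u \<tau>) = norm K * exp (\<tau> * Re \<kappa>)" for \<tau>
      by (simp add: ue norm_mult)
    show ?thesis
    proof (cases "K = 0")
      case True then show ?thesis by (simp add: fun_eq_iff ue)
    next
      case False
      have "(u \<longlongrightarrow> 0) at_bot"
        using tendsto_add[OF tendsto_mult[OF tendsto_of_real[OF lim(2)] tendsto_const]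
            tendsto_mult[OF tendsto_of_real[OF lim(1)] tendsto_const], of \<alpha> \<beta>]
        unfolding u by simp
      from tendsto_norm_zero[OF this] have "((\<lambda>\<tau>. norm K * exp (\<tau> * Re \<kappa>)) \<longlongrightarrow> 0) at_bot"
        by (simp add: nu)
      then have ev: "\<forall>\<^sub>F \<tau> in at_bot. norm K * exp (\<tau> * Re \<kappa>) < norm K"
        using False by (intro order_tendstoD(2)) auto
      have pos: "Re \<kappa> > 0"
      proof -
        obtain \<tau> where t: "\<tau> \<le> -1" "norm K * exp (\<tau> * Re \<kappa>) < norm K"
          using ev unfolding eventually_at_bot_linorder by (meson le_cases order_trans)
        then have "exp (\<tau> * Re \<kappa>) < 1" using False by (simp add: mult_less_cancel_left1)
        then have "\<tau> * Re \<kappa> < 0" by simp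
        then show ?thesis using t(1) by (simp add: mult_less_0_iff)
      qed
      define M where "M = norm \<alpha> + norm \<beta> + 1"
      have M: "M > 0" by (simp add: M_def add_nonneg_pos)
      have lower: "norm K / M * exp (\<tau> * Re \<kappa>) \<le> \<bar>w \<tau>\<bar> + \<bar>w' \<tau>\<bar>" for \<tau>
      proof -
        have "norm (u \<tau>) \<le> \<bar>w' \<tau>\<bar> * norm \<alpha> + \<bar>w \<tau>\<bar> * norm \<beta>"
          unfolding u
          using norm_triangle_ineq[of "of_real (w' \<tau>) * \<alpha>" "of_real (w \<tau>) * \<beta>"] by (simp add: norm_mult)
        also have "\<dots> \<le> \<bar>w' \<tau>\<bar> * M + \<bar>w \<tau>\<bar> * M"
          by (intro add_mono mult_left_mono) (auto simp: M_def)
        finally show ?thesis using M by (simp add: nu field_simps)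
      qed
      have "filterlim (\<lambda>\<tau>::real. norm K / M * exp (\<tau> * Re \<kappa>)) at_top at_top"
        by (rule filterlim_tendsto_pos_mult_at_top[OF tendsto_const _ filterlim_compose[OF exp_at_top
              filterlim_at_top_mult_tendsto_pos[OF tendsto_const pos filterlim_ident]]])
           (use False M in simp)
      then show ?thesis
        by - (rule disjI2, erule filterlim_at_top_mono, rule always_eventually, rule allI, rule lower)
    qed
  qed
  have dwc: "((\<lambda>\<tau>. of_real (w \<tau>) :: complex) has_vector_derivative of_real (w' \<tau>)) (at \<tau>)" for \<tau>
    using dw by (intro has_vector_derivative_of_real) (simp add: has_real_derivative_iff_has_vector_derivative)
  have dwc': "((\<lambda>\<tau>. of_real (w' \<tau>) :: complex) has_vector_derivative of_real (- b * w' \<tau> - c * w \<tau>)) (at \<tau>)" for \<tau>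
    using dw' by (intro has_vector_derivative_of_real) (simp add: has_real_derivative_iff_has_vector_derivative)
  define u where "u = (\<lambda>\<tau>. of_real (w' \<tau>) * 1 + of_real (w \<tau>) * (- \<mu>))"
  have "(u has_vector_derivative \<nu> * u \<tau>) (at \<tau>)" for \<tau>
  proof -
    have "(u has_vector_derivative of_real (- b * w' \<tau> - c * w \<tau>) * 1 + of_real (w' \<tau>) * (- \<mu>)) (at \<tau>)"
      unfolding u_def
      by (intro has_vector_derivative_add has_vector_derivative_mult_left dwc dwc')
    also have "of_real (- b * w' \<tau> - c * w \<tau>) * 1 + of_real (w' \<tau>) * (- \<mu>) =
       (- of_real b) * of_real (w' \<tau>) - of_real c * of_real (w \<tau>) - of_real (w' \<tau>) * \<mu>" by simp
    also have "\<dots> = \<nu> * u \<tau>"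
      unfolding sum[symmetric] prod[symmetric] u_def by (simp add: algebra_simps)
    finally show ?thesis .
  qed
  from growth[OF this u_def] show ?thesis
  proof
    assume "u = (\<lambda>_. 0)"
    then have "of_real (w' \<tau>) = \<mu> * of_real (w \<tau>)" for \<tau>
      by (auto simp: u_def fun_eq_iff mult.commute)
    then have "((\<lambda>\<tau>. of_real (w \<tau>)) has_vector_derivative \<mu> * of_real (w \<tau>)) (at \<tau>)" for \<tau>
      using dwc by metis
    then have "(\<lambda>\<tau>. of_real (w \<tau>) :: complex) = (\<lambda>_. 0) \<or> ?thesis"
      by (rule growth[where \<alpha> = 0 and \<beta> = 1]) simp
    then show ?thesis using nz by (auto simp: fun_eq_iff)
  qed
qed

text \<open>Along such a solution \<open>w\<close> becomes positive, and then \<open>1/w\<^sup>2\<close> decreases at the rate \<open>2/K\<close> at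
  least, so it would have to become negative in finite time.\<close>

lemma cubic_blowup:
  fixes w w' :: "real \<Rightarrow> real"
  assumes dw: "\<And>\<tau>. \<tau> \<ge> T \<Longrightarrow> (w has_real_derivative w' \<tau>) (at \<tau>)"
    and ge1: "\<And>\<tau>. \<tau> \<ge> T \<Longrightarrow> w' \<tau> \<ge> 1"
    and cube: "\<And>\<tau>. \<tau> \<ge> T \<Longrightarrow> \<bar>w \<tau>\<bar> ^ 3 \<le> K * w' \<tau>"
  shows False
proof -
  have lin: "w \<tau> \<ge> w T + (\<tau> - T)" if "\<tau> \<ge> T" for \<tau>
  proof -
    have "w T - T \<le> w \<tau> - \<tau>"
      proof (rule DERIV_nonneg_imp_nondecreasing[OF that, where f = "\<lambda>x. w x - x"])
      fix x assume "T \<le> x"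
      then show "\<exists>y. ((\<lambda>x. w x - x) has_real_derivative y) (at x) \<and> 0 \<le> y"
        using ge1[of x] DERIV_diff[OF dw DERIV_ident, of x] by fastforce
    qed
    then show ?thesis by simp
  qed
  \<comment> \<open>As \<open>w\<close> grows at least with unit speed, \<open>w \<ge> 1\<close> from time \<open>S\<close> on.\<close>
  define S where "S = T + \<bar>w T\<bar> + 1"
  have ST: "S \<ge> T" by (simp add: S_def)
  have w1: "w \<tau> \<ge> 1" if "\<tau> \<ge> S" for \<tau>
    using lin[OF order_trans[OF ST that]] that by (simp add: S_def)
  have "0 < \<bar>w S\<bar> ^ 3" using w1[of S] by simp
  with cube[OF ST] ge1[OF ST] have K: "K > 0"
    by (smt (verit) mult_nonpos_nonneg)
  let ?g = "\<lambda>\<tau>. 1 / (w \<tau>)\<^sup>2 + 2 / K * \<tau>"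
  \<comment> \<open>Over a time span \<open>K\<close> the function \<open>1/w\<^sup>2\<close> would lose \<open>2\<close>, but it starts at \<open>1\<close> at most.\<close>
  have dec: "?g (S + K) \<le> ?g S"
  proof (rule DERIV_nonpos_imp_nonincreasing[where f = ?g])
    show "S \<le> S + K" using K by simp
    fix \<tau> assume t: "S \<le> \<tau>" "\<tau> \<le> S + K"
    have p: "w \<tau> > 0" using w1[OF t(1)] by simp
    have "(?g has_real_derivative - 2 * w' \<tau> / (w \<tau>) ^ 3 + 2 / K) (at \<tau>)"
      using p K by (auto intro!: derivative_eq_intros dw order_trans[OF ST t(1)] simp: field_simps power2_eq_square power3_eq_cube)
    moreover have "- 2 * w' \<tau> / (w \<tau>) ^ 3 + 2 / K \<le> 0"
      using cube[OF order_trans[OF ST t(1)]] p K by (simp add: field_simps)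
    ultimately show "\<exists>y. (?g has_real_derivative y) (at \<tau>) \<and> y \<le> 0" by blast
  qed
  have "1 / (w S)\<^sup>2 \<le> 1" using w1[of S] by (simp add: field_simps one_le_power)
  moreover have "1 / (w (S + K))\<^sup>2 > 0" using w1[of "S + K"] K by simp
  moreover have "2 / K * (S + K) = 2 / K * S + 2" using K by (simp add: field_simps)
  ultimately show False using dec by linarith
qed

lemma cube_le_psi: "\<exists>C. \<forall>x. \<bar>x\<bar> ^ 3 \<le> \<bar>\<psi> t x\<bar> + C"
proof -
  \<comment> \<open>Beyond \<open>R\<close> the lower-order terms of \<open>\<psi>\<close> amount to at most a third of \<open>|x|\<^sup>3\<close>, and \<open>4/3 - 1/3 = 1\<close>.\<close>
  define R where "R = max 1 (3 * (\<bar>t\<bar> + sqrt 6))"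
  have "\<bar>x\<bar> ^ 3 \<le> \<bar>\<psi> t x\<bar> + R ^ 3" for x
  proof (cases "\<bar>x\<bar> \<le> R")
    case True
    then have "\<bar>x\<bar> ^ 3 \<le> R ^ 3" by (intro power_mono) auto
    then show ?thesis by linarith
  next
    case False
    then have x: "\<bar>x\<bar> \<ge> 1" "3 * (\<bar>t\<bar> + sqrt 6) \<le> \<bar>x\<bar>" and R: "R ^ 3 \<ge> 0" by (auto simp: R_def)
    have "\<bar>x\<bar> \<le> x\<^sup>2" using mult_left_mono[OF x(1), of "\<bar>x\<bar>"] by (simp add: power2_eq_square)
    then have "\<bar>t\<bar> * \<bar>x\<bar> \<le> \<bar>t\<bar> * x\<^sup>2" by (intro mult_left_mono) auto
    moreover have "(\<bar>t\<bar> + sqrt 6) * x\<^sup>2 \<le> \<bar>x\<bar> / 3 * x\<^sup>2" using x(2) by (intro mult_right_mono) auto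
    moreover have "\<bar>x\<bar> * x\<^sup>2 = \<bar>x\<bar> ^ 3" by (simp add: power2_eq_square power3_eq_cube)
    ultimately have a: "\<bar>t\<bar> * \<bar>x\<bar> + sqrt 6 * x\<^sup>2 \<le> \<bar>x\<bar> ^ 3 / 3" by (simp add: algebra_simps)
    have "4/3 * x ^ 3 = \<psi> t x - t * x + sqrt 6 * x\<^sup>2" by (simp add: \<psi>_def)
    then have "\<bar>4/3 * x ^ 3\<bar> \<le> \<bar>\<psi> t x\<bar> + \<bar>t * x\<bar> + \<bar>sqrt 6 * x\<^sup>2\<bar>" by linarith
    moreover have "\<bar>4/3 * x ^ 3\<bar> = 4/3 * \<bar>x\<bar> ^ 3" "\<bar>t * x\<bar> = \<bar>t\<bar> * \<bar>x\<bar>" "\<bar>sqrt 6 * x\<^sup>2\<bar> = sqrt 6 * x\<^sup>2"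
      by (simp_all add: abs_mult power_abs)
    ultimately show ?thesis using a R by linarith
  qed
  then show ?thesis by blast
qed

text \<open>The hypothesis \<open>eq\<close> bounds \<open>|w|\<^sup>3\<close> by a multiple of \<open>|w| + |w'| + 1\<close> for \<open>\<tau> \<ge> 0\<close>. As
  \<open>|w| + |w'|\<close> tends to infinity for a nonzero solution, \<open>w'\<close> eventually dominates \<open>w\<close>, keeps its
  sign and satisfies \<open>|w|\<^sup>3 \<le> K |w'|\<close>, so that \<open>w\<close> or \<open>-w\<close> blows up.\<close>

lemma scale_invariant_ODE_zero:
  fixes w w' :: "real \<Rightarrow> real"
  assumes dw: "\<And>\<tau>. (w has_real_derivative w' \<tau>) (at \<tau>)"
    and dw': "\<And>\<tau>. (w' has_real_derivative - b * w' \<tau> - c * w \<tau>) (at \<tau>)"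
    and lim: "(w \<longlongrightarrow> 0) at_bot" "(w' \<longlongrightarrow> 0) at_bot"
    and eq: "\<And>\<tau>. exp (2 * \<tau>) * \<psi> t (w \<tau>) = p * w' \<tau> + q * w \<tau>"
  shows "w \<tau> = 0"
proof (rule ccontr)
  assume "w \<tau> \<noteq> 0"
  then have big: "filterlim (\<lambda>\<tau>. \<bar>w \<tau>\<bar> + \<bar>w' \<tau>\<bar>) at_top at_top"
    using const_coeff_ODE_unbounded[OF dw dw' lim] by blast
  obtain C where C: "\<And>x. \<bar>x\<bar> ^ 3 \<le> \<bar>\<psi> t x\<bar> + C" using cube_le_psi by blast
  define P where "P = \<bar>p\<bar> + \<bar>q\<bar> + \<bar>C\<bar> + 2"
  have P: "P \<ge> 1" by (simp add: P_def)
  have bound: "\<bar>w s\<bar> ^ 3 \<le> P * (\<bar>w s\<bar> + \<bar>w' s\<bar> + 1)" if "s \<ge> 0" for s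
  proof -
    have "\<bar>\<psi> t (w s)\<bar> \<le> exp (2 * s) * \<bar>\<psi> t (w s)\<bar>"
      using that by (simp add: mult_le_cancel_right1)
    also have "\<dots> = \<bar>p * w' s + q * w s\<bar>" by (simp add: eq[symmetric] abs_mult)
    also have "\<dots> \<le> \<bar>p\<bar> * \<bar>w' s\<bar> + \<bar>q\<bar> * \<bar>w s\<bar>" by (metis abs_mult abs_triangle_ineq)
    also have "\<dots> \<le> P * \<bar>w' s\<bar> + P * \<bar>w s\<bar>" by (intro add_mono mult_right_mono) (auto simp: P_def)
    finally have "\<bar>\<psi> t (w s)\<bar> \<le> P * \<bar>w' s\<bar> + P * \<bar>w s\<bar>" .
    moreover have "C \<le> P" by (simp add: P_def)
    ultimately show ?thesis using C[of "w s"] by (simp add: algebra_simps)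
  qed
  \<comment> \<open>Chosen so that \<open>R\<^sup>2 > 3 P\<close>, which makes \<open>|w| \<ge> max R |w'|\<close> contradict \<open>bound\<close>.\<close>
  define R where "R = 2 * P + 1"
  have "\<forall>\<^sub>F s in at_top. \<bar>w s\<bar> + \<bar>w' s\<bar> \<ge> 2 * R"
    using big by (simp add: filterlim_at_top)
  then obtain T0 where T0: "\<And>s. s \<ge> T0 \<Longrightarrow> \<bar>w s\<bar> + \<bar>w' s\<bar> \<ge> 2 * R"
    by (auto simp: eventually_at_top_linorder)
  define T where "T = max T0 0"
  have ww': "\<bar>w s\<bar> \<le> \<bar>w' s\<bar>" if "s \<ge> T" for s
  proof (rule ccontr)
    assume "\<not> ?thesis"
    then have l: "\<bar>w' s\<bar> < \<bar>w s\<bar>" by simp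
    have "\<bar>w s\<bar> + \<bar>w' s\<bar> \<ge> 2 * R" "s \<ge> 0" using T0[of s] that by (auto simp: T_def)
    with l have wR: "\<bar>w s\<bar> \<ge> R" by linarith
    with P have w1: "\<bar>w s\<bar> \<ge> 1" by (simp add: R_def)
    have "\<bar>w s\<bar> ^ 3 \<le> P * (3 * \<bar>w s\<bar>)"
      by (rule order_trans[OF bound[OF \<open>s \<ge> 0\<close>]], rule mult_left_mono) (use l w1 P in auto)
    moreover have "\<bar>w s\<bar> ^ 3 = \<bar>w s\<bar> * (\<bar>w s\<bar> * \<bar>w s\<bar>)" by (simp add: power3_eq_cube)
    moreover have "\<bar>w s\<bar> * \<bar>w s\<bar> \<ge> R * R" using wR P by (intro mult_mono) (auto simp: R_def)
    moreover have "R * R > 3 * P" using P by (simp add: R_def algebra_simps) (smt (verit) mult_nonneg_nonneg)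
    ultimately have "\<bar>w s\<bar> * (\<bar>w s\<bar> * \<bar>w s\<bar>) \<le> \<bar>w s\<bar> * (3 * P)" "3 * P < \<bar>w s\<bar> * \<bar>w s\<bar>"
      by (simp_all add: mult_ac)
    then show False using w1 by (simp only: mult_le_cancel_left) linarith
  qed
  have large: "\<bar>w' s\<bar> \<ge> 1" if "s \<ge> T" for s
    using T0[of s] ww'[OF that] that P by (auto simp: T_def R_def)
  have cube: "\<bar>w s\<bar> ^ 3 \<le> (3 * P) * \<bar>w' s\<bar>" if "s \<ge> T" for s
  proof -
    have "\<bar>w s\<bar> ^ 3 \<le> P * (3 * \<bar>w' s\<bar>)"
      by (rule order_trans[OF bound], use that in \<open>simp add: T_def\<close>, rule mult_left_mono)
         (use ww'[OF that] large[OF that] P in auto)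
    then show ?thesis by simp
  qed
  have cont: "isCont w' s" for s using dw' by (rule DERIV_isCont)
  consider "w' T > 0" | "w' T < 0" using large[of T] by fastforce
  then show False
  proof cases
    case 1
    have "w' s > 0" if s: "s \<ge> T" for s
    proof (rule ccontr)
      assume "\<not> w' s > 0"
      then obtain x where "T \<le> x" "w' x = 0"
        using IVT2[of w' s 0 T] 1 cont s by auto
      then show False using large by fastforce
    qed
    then show False using cubic_blowup[of T w w' "3 * P"] dw large cube by (metis abs_of_pos)
  next
    case 2
    have "w' s < 0" if s: "s \<ge> T" for s
    proof (rule ccontr)
      assume "\<not> w' s < 0"
      then obtain x where "T \<le> x" "w' x = 0"
        using IVT[of w' T 0 s] 2 cont s by auto
      then show False using large by fastforce
    qed
    then show False
      using cubic_blowup[of T "\<lambda>s. - w s" "\<lambda>s. - w' s" "3 * P"] DERIV_minus[OF dw] large cube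
      by (metis abs_minus_cancel abs_of_neg)
  qed
qed

section \<open>The Euler--Lagrange equations along a ray\<close>

text \<open>The left-hand side of the Euler--Lagrange equations as a linear operator on arrays \<open>T i j k l\<close>
  that stand for the second derivatives \<open>Q_ij,kl\<close>. Detached from derivatives, it can be applied
  separately to the coefficient of each derivative of \<open>s\<close>.\<close>

definition elastic :: "real \<Rightarrow> (3 \<Rightarrow> 3 \<Rightarrow> 3 \<Rightarrow> 3 \<Rightarrow> real) \<Rightarrow> 3 \<Rightarrow> 3 \<Rightarrow> real" where
  "elastic L T i j = (\<Sum>k\<in>UNIV. T i j k k)
     + L / 2 * ((\<Sum>k\<in>UNIV. T i k k j) + (\<Sum>k\<in>UNIV. T j k k i)
         - 2/3 * mat 1 $ i $ j * (\<Sum>k\<in>UNIV. \<Sum>l\<in>UNIV. T k l k l))"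

lemma elastic_linear:
  "elastic L (\<lambda>i j k l. a * T i j k l + b * U i j k l + c * V i j k l) i j
    = a * elastic L T i j + b * elastic L U i j + c * elastic L V i j"
  by (simp add: elastic_def sum.distrib sum_distrib_left[symmetric] algebra_simps)

lemma elastic_scale:
  "elastic L (\<lambda>i j k l. a * T i j k l) i j = a * elastic L T i j"
  using elastic_linear[of L a T 0 T 0 T] by simp

lemma uniaxial_tensor_nth:
  "uniaxial_tensor s m $ i $ j = s * (m $ i * m $ j - mat 1 $ i $ j / 3)"
  by (simp add: uniaxial_tensor_def outer_def)

text \<open>The square of \<open>P = s (m \<otimes> m - I/3)\<close> is \<open>s\<^sup>2 (m \<otimes> m / 3 + I/9)\<close>, whose traceless part is
  again a multiple of \<open>P\<close>; this is why the bulk term has no component transverse to \<open>P\<close>.\<close>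

lemma bulk_term_uniaxial:
  fixes m :: "real^3" and s t :: real
  assumes "norm m = 1"
  defines "P \<equiv> uniaxial_tensor s m"
  shows "t * P $ i $ j - 3 * sqrt 6 * ((\<Sum>k\<in>UNIV. P $ i $ k * P $ k $ j)
              - 1/3 * mat 1 $ i $ j * trace (P ** P)) + 2 * P $ i $ j * trace (P ** P)
       = \<psi> t s * (m $ i * m $ j - mat 1 $ i $ j / 3)"
proof -
  have mm: "(\<Sum>k\<in>UNIV. m $ k * m $ k) = 1"
    using assms(1) by (simp add: norm_eq_1 inner_vec_def)
  have sq: "(\<Sum>k\<in>UNIV. P $ i $ k * P $ k $ j) = s\<^sup>2 * (m $ i * m $ j / 3 + mat 1 $ i $ j / 9)" for i j
  proof -
    have "(\<Sum>k\<in>UNIV. P $ i $ k * P $ k $ j) = s\<^sup>2 * (\<Sum>k\<in>UNIV. m $ i * m $ j * (m $ k * m $ k)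
       - (m $ i / 3) * (m $ k * mat 1 $ k $ j) - (m $ j / 3) * (m $ k * mat 1 $ i $ k)
       + (mat 1 $ i $ k * mat 1 $ k $ j) / 9)"
      unfolding P_def uniaxial_tensor_nth sum_distrib_left
      by (rule sum.cong) (simp_all add: power2_eq_square field_simps)
    also have "\<dots> = s\<^sup>2 * (m $ i * m $ j * (\<Sum>k\<in>UNIV. m $ k * m $ k)
       - (m $ i / 3) * (\<Sum>k\<in>UNIV. m $ k * mat 1 $ k $ j) - (m $ j / 3) * (\<Sum>k\<in>UNIV. m $ k * mat 1 $ i $ k)
       + (\<Sum>k\<in>UNIV. mat 1 $ i $ k * mat 1 $ k $ j) / 9)"
      by (simp add: sum.distrib sum_subtractf sum_distrib_left sum_divide_distrib)
    also have "(\<Sum>k\<in>UNIV. m $ k * mat 1 $ k $ j) = m $ j"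
      by (simp add: mat_def if_distrib sum.delta cong: if_cong)
    also have "(\<Sum>k\<in>UNIV. m $ k * mat 1 $ i $ k) = m $ i"
      by (simp add: mat_def if_distrib sum.delta cong: if_cong)
    also have "(\<Sum>k\<in>UNIV. mat 1 $ i $ k * mat 1 $ k $ j :: real) = mat 1 $ i $ j"
      using matrix_mul_lid[of "mat 1 :: real^3^3"] by (simp add: matrix_matrix_mult_def vec_eq_iff)
    finally show ?thesis unfolding mm by (simp add: field_simps)
  qed
  have "trace (P ** P) = (\<Sum>i\<in>UNIV. s\<^sup>2 * (m $ i * m $ i / 3 + mat 1 $ i $ i / 9))"
    by (simp add: trace_def matrix_matrix_mult_def sq)
  also have "\<dots> = s\<^sup>2 * ((\<Sum>i\<in>UNIV. m $ i * m $ i) / 3 + 1 / 3)"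
    by (simp add: sum_3 mat_def algebra_simps)
  finally have tr: "trace (P ** P) = 2/3 * s\<^sup>2" by (simp add: mm)
  show ?thesis
    unfolding sq tr unfolding P_def uniaxial_tensor_nth \<psi>_def
    by (simp add: field_simps power2_eq_square power3_eq_cube)
qed

definition quadratic_form :: "(3 \<Rightarrow> 3 \<Rightarrow> real) \<Rightarrow> real^3 \<Rightarrow> real" where
  "quadratic_form T u = (\<Sum>i\<in>UNIV. \<Sum>j\<in>UNIV. u $ i * u $ j * T i j)"

lemma quadratic_form_linear:
  "quadratic_form (\<lambda>i j. a * T i j + b * U i j + c * V i j) u
    = a * quadratic_form T u + b * quadratic_form U u + c * quadratic_form V u"
  by (simp add: quadratic_form_def sum.distrib sum_distrib_left algebra_simps)

lemma quadratic_form_scale: "quadratic_form (\<lambda>i j. a * T i j) u = a * quadratic_form T u"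
  using quadratic_form_linear[of a T 0 T 0 T u] by simp

lemma quadratic_form_expand:
  fixes u m \<omega> :: "real^3"
  shows "quadratic_form (\<lambda>i j. \<alpha> * (m $ i * m $ j)
      + \<beta> * (m $ i * \<omega> $ j + \<omega> $ i * m $ j) + \<gamma> * (\<omega> $ i * \<omega> $ j) + \<delta> * mat 1 $ i $ j) u
    = \<alpha> * (u \<bullet> m)\<^sup>2 + 2 * \<beta> * (u \<bullet> m) * (u \<bullet> \<omega>) + \<gamma> * (u \<bullet> \<omega>)\<^sup>2 + \<delta> * (u \<bullet> u)"
  by (simp add: quadratic_form_def sum_3 inner_vec_def mat_def power2_eq_square algebra_simps)

lemma quadratic_form_director:
  "quadratic_form (\<lambda>i j. m $ i * m $ j - mat 1 $ i $ j / 3) u = (u \<bullet> m)\<^sup>2 - (u \<bullet> u) / 3"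
  using quadratic_form_expand[of 1 m 0 0 0 "-1/3" u] by simp

text \<open>The coefficient of \<open>s''\<close>. The term \<open>\<omega> \<otimes> \<omega>\<close> comes only with the factor \<open>L\<close>; it is the source
  of biaxiality when \<open>\<omega>\<close> is oblique to the director.\<close>

lemma elastic_leading_term:
  fixes m \<omega> :: "real^3"
  assumes "norm m = 1" "norm \<omega> = 1"
  defines "c \<equiv> m \<bullet> \<omega>"
  shows "elastic L (\<lambda>i j k l. \<omega> $ k * \<omega> $ l * (m $ i * m $ j - mat 1 $ i $ j / 3)) i j
    = 1 * (m $ i * m $ j) + L / 2 * c * (m $ i * \<omega> $ j + \<omega> $ i * m $ j)
      + (- L / 3) * (\<omega> $ i * \<omega> $ j) + (- 1/3 - L / 3 * (c\<^sup>2 - 1/3)) * mat 1 $ i $ j"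
proof -
  have ww: "(\<Sum>k\<in>UNIV. \<omega> $ k * \<omega> $ k) = 1"
    using assms(2) by (simp add: norm_eq_1 inner_vec_def)
  have d: "(\<Sum>k\<in>UNIV. \<omega> $ k * \<omega> $ k * (m $ i * m $ j - mat 1 $ i $ j / 3)) = m $ i * m $ j - mat 1 $ i $ j / 3"
    by (simp add: sum_distrib_right[symmetric] ww)
  have a: "(\<Sum>k\<in>UNIV. \<omega> $ k * \<omega> $ j * (m $ i * m $ k - mat 1 $ i $ k / 3))
      = (c * m $ i - \<omega> $ i / 3) * \<omega> $ j" for i j
  proof -
    have "(\<Sum>k\<in>UNIV. \<omega> $ k * \<omega> $ j * (m $ i * m $ k - mat 1 $ i $ k / 3))
       = (m $ i * (\<Sum>k\<in>UNIV. m $ k * \<omega> $ k) - (\<Sum>k\<in>UNIV. \<omega> $ k * mat 1 $ i $ k) / 3) * \<omega> $ j"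
      unfolding sum_distrib_left sum_distrib_right sum_divide_distrib sum_subtractf[symmetric]
      by (rule sum.cong) (simp_all add: algebra_simps)
    also have "(\<Sum>k\<in>UNIV. \<omega> $ k * mat 1 $ i $ k) = \<omega> $ i"
      by (simp add: mat_def if_distrib sum.delta cong: if_cong)
    finally show ?thesis by (simp add: c_def inner_vec_def mult.commute)
  qed
  have tr: "(\<Sum>k\<in>UNIV. \<Sum>l\<in>UNIV. \<omega> $ k * \<omega> $ l * (m $ k * m $ l - mat 1 $ k $ l / 3)) = c\<^sup>2 - 1/3"
    using quadratic_form_director[of m \<omega>] assms(2)
    by (simp add: quadratic_form_def c_def inner_commute norm_eq_1)
  show ?thesis
    unfolding elastic_def d a tr by (simp add: field_simps)
qed

text \<open>The functional \<open>T \<mapsto> T(v,v) + (e/2) T(m,m)\<close>, with \<open>v\<close> the component of \<open>\<omega>\<close> orthogonal to the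
  director and \<open>e = |v|\<^sup>2\<close>, measures the biaxiality of a traceless tensor in the plane orthogonal to
  \<open>m\<close>: as the trace over that plane is \<open>-T(m,m)\<close>, the second summand removes the isotropic part of
  the restriction of \<open>T\<close> to it. Therefore it annihilates the uniaxial tensor, but it does not
  annihilate the leading coefficient if \<open>L \<noteq> 0\<close> and \<open>\<omega>\<close> is not parallel to \<open>m\<close>.\<close>

lemma oblique_functional:
  fixes m \<omega> :: "real^3" and L :: real
  assumes "norm m = 1" "norm \<omega> = 1"
  defines "e \<equiv> 1 - (m \<bullet> \<omega>)\<^sup>2" and "v \<equiv> \<omega> - (m \<bullet> \<omega>) *\<^sub>R m"
  defines "A \<equiv> \<lambda>i j. m $ i * m $ j - mat 1 $ i $ j / 3"
  defines "M \<equiv> elastic L (\<lambda>i j k l. \<omega> $ k * \<omega> $ l * A i j)"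
  shows "quadratic_form A v + e / 2 * quadratic_form A m = 0"
    and "quadratic_form M v + e / 2 * quadratic_form M m = - L / 6 * e\<^sup>2"
proof -
  have mm: "m \<bullet> m = 1" and ww: "\<omega> \<bullet> \<omega> = 1" using assms by (simp_all add: norm_eq_1)
  have v: "v \<bullet> m = 0" "v \<bullet> \<omega> = e" "v \<bullet> v = e"
    by (simp_all add: v_def e_def inner_diff inner_commute mm ww power2_eq_square algebra_simps)
  show "quadratic_form A v + e / 2 * quadratic_form A m = 0"
    by (simp add: A_def quadratic_form_director v mm)
  show "quadratic_form M v + e / 2 * quadratic_form M m = - L / 6 * e\<^sup>2"
    unfolding M_def A_def elastic_leading_term[OF assms(1,2)] quadratic_form_expand v mm
    by (simp add: e_def power2_eq_square field_simps)
qed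

lemma unit_vectors_parallel:
  fixes m \<omega> :: "real^3"
  assumes "norm m = 1" "norm \<omega> = 1" "1 - (m \<bullet> \<omega>)\<^sup>2 = 0"
  shows "m = \<omega> \<or> m = - \<omega>"
proof -
  have "m \<bullet> \<omega> = 1 \<or> m \<bullet> \<omega> = -1" using assms(3) by (simp add: power2_eq_1_iff)
  moreover have "(m - (m \<bullet> \<omega>) *\<^sub>R \<omega>) \<bullet> (m - (m \<bullet> \<omega>) *\<^sub>R \<omega>) = 0"
    using assms by (simp add: inner_diff inner_commute norm_eq_1 power2_eq_square algebra_simps)
  then have "m = (m \<bullet> \<omega>) *\<^sub>R \<omega>" by simp
  ultimately show ?thesis by (metis scaleR_minus1_left scaleR_one)
qed

text \<open>Rescaling \<open>q\<close> by \<open>r\<close> moves the base point from \<open>r \<omega>\<close> to the fixed point \<open>\<omega>\<close>. Thus \<open>r\<close> enters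
  through \<open>s\<close> only, and the derivatives of \<open>B\<close> are evaluated at \<open>\<omega>\<close>; their homogeneity degrees
  need not be established separately.\<close>

lemma scaled_second_partials:
  fixes q B :: "real^3 \<Rightarrow> real"
  assumes q: "C2 q" and B: "twice_differentiable_off_0 B"
    and s1: "\<And>r. r > 0 \<Longrightarrow> (s has_real_derivative s' r) (at r)"
    and s2: "\<And>r. r > 0 \<Longrightarrow> (s' has_real_derivative s'' r) (at r)"
    and eq: "\<And>r x. r > 0 \<Longrightarrow> x \<noteq> 0 \<Longrightarrow> q (r *\<^sub>R x) = s (r * norm x) * B x"
    and r: "r > 0" and \<omega>: "norm \<omega> = 1"
  shows "r\<^sup>2 * partial l (partial k q) (r *\<^sub>R \<omega>)
    = r\<^sup>2 * s'' r * (\<omega> $ k * \<omega> $ l * B \<omega>)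
      + r * s' r * ((axis k 1 $ l - \<omega> $ k * \<omega> $ l) * B \<omega> + \<omega> $ k * partial l B \<omega> + \<omega> $ l * partial k B \<omega>)
      + s r * partial l (partial k B) \<omega>"
proof -
  have q1: "q differentiable at x" and q2: "partial k q differentiable at x" for x k
    using q by (auto simp: C2_def)
  have w0: "\<omega> \<noteq> 0" using \<omega> by auto
  have pk: "partial k (\<lambda>x. q (r *\<^sub>R x)) = (\<lambda>x. r * partial k q (r *\<^sub>R x))"
    using partial_scale(2)[OF q1] by (simp add: fun_eq_iff)
  have "partial l (partial k (\<lambda>x. q (r *\<^sub>R x))) \<omega> = r * partial l (\<lambda>x. partial k q (r *\<^sub>R x)) \<omega>"
    unfolding pk partial_eqI[OF has_derivative_mult_right[OF partial_scale(1)[OF q2]]]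
      partial_eqI[OF partial_scale(1)[OF q2]] by simp
  also have "\<dots> = r\<^sup>2 * partial l (partial k q) (r *\<^sub>R \<omega>)"
    by (simp add: partial_scale(2)[OF q2] power2_eq_square)
  finally have "r\<^sup>2 * partial l (partial k q) (r *\<^sub>R \<omega>) = partial l (partial k (\<lambda>x. q (r *\<^sub>R x))) \<omega>" ..
  also have "\<dots> = partial l (partial k (\<lambda>x. s (r * norm x) * B x)) \<omega>"
  proof (rule partial_transform_within_open[of "-{0}"])
    fix y :: "real^3" assume "y \<in> -{0}"
    then show "partial k (\<lambda>x. q (r *\<^sub>R x)) y = partial k (\<lambda>x. s (r * norm x) * B x) y"
      by (intro partial_transform_within_open[of "-{0}"]) (auto simp: eq[OF r])
  qed (use w0 in auto)
  also have "\<dots> = (r * (r * s'' (r * norm \<omega>))) * (\<omega> $ k * \<omega> $ l / norm \<omega> ^ 2) * B \<omega>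
      + (r * s' (r * norm \<omega>)) * ((axis k 1 $ l / norm \<omega> - \<omega> $ k * \<omega> $ l / norm \<omega> ^ 3) * B \<omega>
          + \<omega> $ k / norm \<omega> * partial l B \<omega> + \<omega> $ l / norm \<omega> * partial k B \<omega>)
      + s (r * norm \<omega>) * partial l (partial k B) \<omega>"
  proof (rule partial_partial_radial_product[OF w0, where f = "\<lambda>\<rho>. s (r * \<rho>)"
        and f' = "\<lambda>\<rho>. r * s' (r * \<rho>)" and f'' = "\<lambda>\<rho>. r * (r * s'' (r * \<rho>))"])
    have lin: "((\<lambda>\<rho>. r * \<rho>) has_real_derivative r) (at \<rho>)" for \<rho>
      by (auto intro!: derivative_eq_intros)
    show "((\<lambda>\<rho>. s (r * \<rho>)) has_real_derivative r * s' (r * \<rho>)) (at \<rho>)" if "\<rho> > 0" for \<rho>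
      using DERIV_chain2[OF s1 lin, of \<rho>] that r by (simp add: mult.commute)
    show "((\<lambda>\<rho>. r * s' (r * \<rho>)) has_real_derivative r * (r * s'' (r * \<rho>))) (at \<rho>)" if "\<rho> > 0" for \<rho>
      using DERIV_cmult[OF DERIV_chain2[OF s2 lin, of \<rho>], of r] that r by (simp add: mult.commute)
  qed (use B in \<open>auto simp: twice_differentiable_off_0_def\<close>)
  finally show ?thesis unfolding \<omega> by (simp add: power2_eq_square algebra_simps)
qed

lemma Euler_Lagrange_on_ray:
  fixes Q A :: "real^3 \<Rightarrow> real^3^3"
  assumes EL: "Euler_Lagrange_solution t L Q"
    and B: "\<And>i j. twice_differentiable_off_0 (\<lambda>x. A x $ i $ j)"
    and s1: "\<And>r. r > 0 \<Longrightarrow> (s has_real_derivative s' r) (at r)"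
    and s2: "\<And>r. r > 0 \<Longrightarrow> (s' has_real_derivative s'' r) (at r)"
    and eq: "\<And>r x. r > 0 \<Longrightarrow> x \<noteq> 0 \<Longrightarrow> Q (r *\<^sub>R x) = s (r * norm x) *\<^sub>R A x"
    and r: "r > 0" and \<omega>: "norm \<omega> = 1" and m: "norm m = 1" "A \<omega> = uniaxial_tensor 1 m"
  shows "r\<^sup>2 * s'' r * elastic L (\<lambda>i j k l. \<omega> $ k * \<omega> $ l * A \<omega> $ i $ j) i j
      + r * s' r * elastic L (\<lambda>i j k l. (axis k 1 $ l - \<omega> $ k * \<omega> $ l) * A \<omega> $ i $ j
           + \<omega> $ k * partial l (\<lambda>x. A x $ i $ j) \<omega> + \<omega> $ l * partial k (\<lambda>x. A x $ i $ j) \<omega>) i j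
      + s r * elastic L (\<lambda>i j k l. partial l (partial k (\<lambda>x. A x $ i $ j)) \<omega>) i j
    = r\<^sup>2 * \<psi> t (s r) * A \<omega> $ i $ j"
proof -
  have "\<omega> \<noteq> 0" using \<omega> by auto
  from eq[OF r this] have Qr: "Q (r *\<^sub>R \<omega>) = uniaxial_tensor (s r) m"
    by (simp add: \<omega> m uniaxial_tensor_def)
  have "elastic L (\<lambda>i j k l. D2 Q i j k l (r *\<^sub>R \<omega>)) i j = \<psi> t (s r) * A \<omega> $ i $ j"
  proof -
    let ?P = "Q (r *\<^sub>R \<omega>)"
    have "elastic L (\<lambda>i j k l. D2 Q i j k l (r *\<^sub>R \<omega>)) i j
      = t * ?P $ i $ j - 3 * sqrt 6 * ((\<Sum>k\<in>UNIV. ?P $ i $ k * ?P $ k $ j)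
              - 1/3 * mat 1 $ i $ j * trace (?P ** ?P)) + 2 * ?P $ i $ j * trace (?P ** ?P)"
      using EL unfolding Euler_Lagrange_solution_def elastic_def by blast
    then show ?thesis
      unfolding Qr bulk_term_uniaxial[OF m(1)] by (simp add: m(2) uniaxial_tensor_nth)
  qed
  then have "r\<^sup>2 * \<psi> t (s r) * A \<omega> $ i $ j = elastic L (\<lambda>i j k l. r\<^sup>2 * D2 Q i j k l (r *\<^sub>R \<omega>)) i j"
    by (simp add: elastic_scale)
  also have "(\<lambda>i j k l. r\<^sup>2 * D2 Q i j k l (r *\<^sub>R \<omega>)) = (\<lambda>i j k l.
     r\<^sup>2 * s'' r * (\<omega> $ k * \<omega> $ l * A \<omega> $ i $ j)
      + r * s' r * ((axis k 1 $ l - \<omega> $ k * \<omega> $ l) * A \<omega> $ i $ j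
           + \<omega> $ k * partial l (\<lambda>x. A x $ i $ j) \<omega> + \<omega> $ l * partial k (\<lambda>x. A x $ i $ j) \<omega>)
      + s r * partial l (partial k (\<lambda>x. A x $ i $ j)) \<omega>)"
  proof (intro ext)
    fix i j k l
    have "C2 (\<lambda>x. Q x $ i $ j)" using EL by (simp add: Euler_Lagrange_solution_def)
    from scaled_second_partials[OF this B s1 s2 _ r \<omega>, of i j l k]
    show "r\<^sup>2 * D2 Q i j k l (r *\<^sub>R \<omega>) = r\<^sup>2 * s'' r * (\<omega> $ k * \<omega> $ l * A \<omega> $ i $ j)
      + r * s' r * ((axis k 1 $ l - \<omega> $ k * \<omega> $ l) * A \<omega> $ i $ j
           + \<omega> $ k * partial l (\<lambda>x. A x $ i $ j) \<omega> + \<omega> $ l * partial k (\<lambda>x. A x $ i $ j) \<omega>)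
      + s r * partial l (partial k (\<lambda>x. A x $ i $ j)) \<omega>"
      by (simp add: D2_def eq)
  qed
  finally show ?thesis unfolding elastic_linear ..
qed

text \<open>The biaxial functional \<open>F\<close> of \<open>oblique_functional\<close> yields an Euler equation for \<open>s\<close>, and the
  quadratic form \<open>N\<close> in the direction \<open>m\<close> yields the relation with \<open>\<psi>\<close>. A director that is not
  parallel to \<open>\<omega>\<close> makes the leading coefficient \<open>F E0\<close> nonzero and hence forces \<open>s = 0\<close>.\<close>

lemma director_radial:
  fixes Q A :: "real^3 \<Rightarrow> real^3^3"
  assumes EL: "Euler_Lagrange_solution t L Q" and L: "L \<noteq> 0"
    and B: "\<And>i j. twice_differentiable_off_0 (\<lambda>x. A x $ i $ j)"
    and s1: "\<And>r. r > 0 \<Longrightarrow> (s has_real_derivative s' r) (at r)"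
    and s2: "\<And>r. r > 0 \<Longrightarrow> (s' has_real_derivative s'' r) (at r)"
    and s0: "(s \<longlongrightarrow> 0) (at_right 0)" "((\<lambda>r. r * s' r) \<longlongrightarrow> 0) (at_right 0)"
    and nz: "\<rho> > 0" "s \<rho> \<noteq> 0"
    and eq: "\<And>r x. r > 0 \<Longrightarrow> x \<noteq> 0 \<Longrightarrow> Q (r *\<^sub>R x) = s (r * norm x) *\<^sub>R A x"
    and \<omega>: "norm \<omega> = 1" and m: "norm m = 1" "A \<omega> = uniaxial_tensor 1 m"
  shows "m = \<omega> \<or> m = - \<omega>"
proof (rule unit_vectors_parallel[OF m(1) \<omega>], rule ccontr)
  define e where "e = 1 - (m \<bullet> \<omega>)\<^sup>2"
  assume "1 - (m \<bullet> \<omega>)\<^sup>2 \<noteq> 0"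
  then have e: "e \<noteq> 0" by (simp add: e_def)
  define v where "v = \<omega> - (m \<bullet> \<omega>) *\<^sub>R m"
  have Aij: "A \<omega> $ i $ j = m $ i * m $ j - mat 1 $ i $ j / 3" for i j
    by (simp add: m(2) uniaxial_tensor_nth)
  define E0 where "E0 = elastic L (\<lambda>i j k l. \<omega> $ k * \<omega> $ l * A \<omega> $ i $ j)"
  define E1 where "E1 = elastic L (\<lambda>i j k l. (axis k 1 $ l - \<omega> $ k * \<omega> $ l) * A \<omega> $ i $ j
           + \<omega> $ k * partial l (\<lambda>x. A x $ i $ j) \<omega> + \<omega> $ l * partial k (\<lambda>x. A x $ i $ j) \<omega>)"
  define E2 where "E2 = elastic L (\<lambda>i j k l. partial l (partial k (\<lambda>x. A x $ i $ j)) \<omega>)"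
  define A0 where "A0 = (\<lambda>i j. A \<omega> $ i $ j)"
  have ray: "r\<^sup>2 * \<psi> t (s r) * A0 i j = r\<^sup>2 * s'' r * E0 i j + r * s' r * E1 i j + s r * E2 i j"
    if "r > 0" for r i j
    unfolding E0_def E1_def E2_def A0_def
    by (rule Euler_Lagrange_on_ray[OF EL B s1 s2 eq that \<omega> m, symmetric])
  have ray_form: "r\<^sup>2 * \<psi> t (s r) * quadratic_form A0 u
      = r\<^sup>2 * s'' r * quadratic_form E0 u + r * s' r * quadratic_form E1 u + s r * quadratic_form E2 u"
    if "r > 0" for r u
  proof -
    have "quadratic_form (\<lambda>i j. r\<^sup>2 * \<psi> t (s r) * A0 i j) u
        = quadratic_form (\<lambda>i j. r\<^sup>2 * s'' r * E0 i j + r * s' r * E1 i j + s r * E2 i j) u"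
      unfolding ray[OF that] ..
    then show ?thesis unfolding quadratic_form_linear quadratic_form_scale .
  qed
  define F where "F = (\<lambda>T. quadratic_form T v + e / 2 * quadratic_form T m)"
  define N where "N = (\<lambda>T. quadratic_form T m)"
  have rayN: "r\<^sup>2 * \<psi> t (s r) * N A0 = r\<^sup>2 * s'' r * N E0 + r * s' r * N E1 + s r * N E2" if "r > 0" for r
    unfolding N_def by (rule ray_form[OF that])
  have rayF: "r\<^sup>2 * \<psi> t (s r) * F A0 = r\<^sup>2 * s'' r * F E0 + r * s' r * F E1 + s r * F E2" if "r > 0" for r
  proof -
    have "r\<^sup>2 * \<psi> t (s r) * F A0 = r\<^sup>2 * \<psi> t (s r) * quadratic_form A0 v
        + e / 2 * (r\<^sup>2 * \<psi> t (s r) * quadratic_form A0 m)"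
      by (simp add: F_def algebra_simps)
    then show ?thesis unfolding ray_form[OF that] by (simp add: F_def algebra_simps)
  qed
  have FA: "F A0 = 0" and FE: "F E0 = - L / 6 * e\<^sup>2"
    using oblique_functional(1)[OF m(1) \<omega>] oblique_functional(2)[OF m(1) \<omega>, of L]
    by (simp_all add: F_def A0_def E0_def Aij e_def v_def)
  have NA: "N A0 = 2/3"
    using m(1) by (simp add: N_def A0_def Aij quadratic_form_director norm_eq_1)
  have FE0: "F E0 \<noteq> 0" using FE e L by simp
  define b1 where "b1 = F E1 / F E0"
  define c where "c = F E2 / F E0"
  have ode: "r\<^sup>2 * s'' r = - b1 * (r * s' r) - c * s r" if "r > 0" for r
    using rayF[OF that] FE0 by (simp add: FA b1_def c_def field_simps)
  \<comment> \<open>In logarithmic time the Euler equation has constant coefficients; since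
    \<open>w'' = r\<^sup>2 s'' + r s'\<close>, the coefficient of \<open>w'\<close> drops by \<open>1\<close>.\<close>
  define w where "w = (\<lambda>\<tau>. s (exp \<tau>))"
  define w' where "w' = (\<lambda>\<tau>. exp \<tau> * s' (exp \<tau>))"
  have "w (ln \<rho>) = 0"
  proof (rule scale_invariant_ODE_zero[where w = w and w' = w' and b = "b1 - 1" and c = c and t = t
        and p = "3/2 * (N E1 - b1 * N E0)" and q = "3/2 * (N E2 - c * N E0)"])
    show "(w has_real_derivative w' \<tau>) (at \<tau>)" for \<tau>
      using DERIV_chain2[OF s1 DERIV_exp, of \<tau>] by (simp add: w_def w'_def mult.commute)
    show "(w' has_real_derivative - (b1 - 1) * w' \<tau> - c * w \<tau>) (at \<tau>)" for \<tau>
    proof -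
      have "(w' has_real_derivative exp \<tau> * s' (exp \<tau>) + s'' (exp \<tau>) * exp \<tau> * exp \<tau>) (at \<tau>)"
        unfolding w'_def by (rule DERIV_mult[OF DERIV_exp DERIV_chain2[OF s2 DERIV_exp]]) simp
      then show ?thesis
        by (rule DERIV_cong)
           (use ode[of "exp \<tau>"] in \<open>simp add: w_def w'_def power2_eq_square algebra_simps\<close>)
    qed
    have ex: "filterlim exp (at_right (0::real)) at_bot"
      by (auto simp: filterlim_at exp_at_bot)
    show "(w \<longlongrightarrow> 0) at_bot" "(w' \<longlongrightarrow> 0) at_bot"
      unfolding w_def w'_def using filterlim_compose[OF s0(1) ex] filterlim_compose[OF s0(2) ex] by auto
    show "exp (2 * \<tau>) * \<psi> t (w \<tau>)
       = 3/2 * (N E1 - b1 * N E0) * w' \<tau> + 3/2 * (N E2 - c * N E0) * w \<tau>" for \<tau>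
    proof -
      have "exp (2 * \<tau>) = (exp \<tau>)\<^sup>2" by (simp add: power2_eq_square exp_add[symmetric])
      moreover have "(exp \<tau>)\<^sup>2 * \<psi> t (s (exp \<tau>)) * (2/3)
         = (- b1 * (exp \<tau> * s' (exp \<tau>)) - c * s (exp \<tau>)) * N E0 + exp \<tau> * s' (exp \<tau>) * N E1 + s (exp \<tau>) * N E2"
        using rayN[of "exp \<tau>"] ode[of "exp \<tau>"] by (simp add: NA)
      ultimately show ?thesis by (simp add: w_def w'_def field_simps)
    qed
  qed
  with nz show False by (simp add: w_def)
qed

section \<open>The hedgehog\<close>

lemma hedgehog_partial:
  fixes x :: "real^3"
  assumes "x \<noteq> 0"
  shows "partial k (\<lambda>x. x $ i * x $ j / (x \<bullet> x) - c) x
    = (axis k 1 $ i * x $ j + axis k 1 $ j * x $ i) / (x \<bullet> x) - 2 * x $ i * x $ j * x $ k / (x \<bullet> x)\<^sup>2"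
proof -
  have d: "((\<lambda>x. x $ i * x $ j / (x \<bullet> x) - c) has_derivative
     (\<lambda>h. (h $ i * x $ j + h $ j * x $ i) / (x \<bullet> x) - 2 * x $ i * x $ j * (x \<bullet> h) / (x \<bullet> x)\<^sup>2)) (at x)"
    using assms
    by (auto intro!: derivative_eq_intros bounded_linear_imp_has_derivative[OF bounded_linear_vec_nth]
        simp: fun_eq_iff field_simps power2_eq_square inner_commute)
  show ?thesis using partial_eqI[OF d] by (simp add: inner_axis)
qed

lemma hedgehog_partial_partial:
  fixes x :: "real^3"
  assumes x: "x \<bullet> x = 1"
  shows "partial l (partial k (\<lambda>x. x $ i * x $ j / (x \<bullet> x) - c)) x
    = axis k 1 $ i * axis l 1 $ j + axis k 1 $ j * axis l 1 $ i
      - 2 * x $ l * (axis k 1 $ i * x $ j + axis k 1 $ j * x $ i)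
      - 2 * (axis l 1 $ i * x $ j * x $ k + axis l 1 $ j * x $ i * x $ k + axis l 1 $ k * x $ i * x $ j)
      + 8 * x $ i * x $ j * x $ k * x $ l"
proof -
  let ?g = "\<lambda>x::real^3. (axis k 1 $ i * x $ j + axis k 1 $ j * x $ i) / (x \<bullet> x) - 2 * x $ i * x $ j * x $ k / (x \<bullet> x)\<^sup>2"
  have x0: "x \<noteq> 0" using x by auto
  have "partial l (partial k (\<lambda>x. x $ i * x $ j / (x \<bullet> x) - c)) x = partial l ?g x"
    by (rule partial_transform_within_open[of "-{0}"]) (use x0 hedgehog_partial in auto)
  also have "(?g has_derivative (\<lambda>h. axis k 1 $ i * h $ j + axis k 1 $ j * h $ i
      - 2 * (x \<bullet> h) * (axis k 1 $ i * x $ j + axis k 1 $ j * x $ i)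
      - 2 * (h $ i * x $ j * x $ k + h $ j * x $ i * x $ k + h $ k * x $ i * x $ j)
      + 8 * x $ i * x $ j * x $ k * (x \<bullet> h))) (at x)"
    using x
    by (auto intro!: derivative_eq_intros bounded_linear_imp_has_derivative[OF bounded_linear_vec_nth]
        simp: fun_eq_iff algebra_simps inner_commute)
  note partial_eqI[OF this]
  finally show ?thesis by (simp add: inner_axis)
qed

text \<open>By rotational symmetry one entry of the system at points of one ray carries all the information.
  At points of the third axis the entry \<open>(3,3)\<close> is convenient: there \<open>A\<close> is diagonal with entries
  \<open>-1/3, -1/3, 2/3\<close>.\<close>

lemma hedgehog_radial_equation:
  fixes Q A :: "real^3 \<Rightarrow> real^3^3"
  assumes EL: "Euler_Lagrange_solution t L Q"
    and B: "\<And>i j. twice_differentiable_off_0 (\<lambda>x. A x $ i $ j)"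
    and s1: "\<And>r. r > 0 \<Longrightarrow> (s has_real_derivative s' r) (at r)"
    and s2: "\<And>r. r > 0 \<Longrightarrow> (s' has_real_derivative s'' r) (at r)"
    and eq: "\<And>r x. r > 0 \<Longrightarrow> x \<noteq> 0 \<Longrightarrow> Q (r *\<^sub>R x) = s (r * norm x) *\<^sub>R A x"
    and A: "\<And>x i j. x \<noteq> 0 \<Longrightarrow> A x $ i $ j = x $ i * x $ j / (x \<bullet> x) - mat 1 $ i $ j / 3"
    and r: "r > 0"
  shows "(1 + 2/3 * L) * (s'' r + 2 / r * s' r) = (1 + 2/3 * L) * (6 / r\<^sup>2) * s r + \<psi> t (s r)"
proof -
  define \<omega> :: "real^3" where "\<omega> = axis 3 1"
  have w: "norm \<omega> = 1" "\<omega> \<bullet> \<omega> = 1" "\<omega> \<noteq> 0" by (auto simp: \<omega>_def inner_axis_axis)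
  have Aw: "A \<omega> = uniaxial_tensor 1 \<omega>"
    by (simp add: vec_eq_iff uniaxial_tensor_nth A[OF w(3)] w)
  have p: "partial k (\<lambda>x. A x $ i $ j) x = partial k (\<lambda>x. x $ i * x $ j / (x \<bullet> x) - mat 1 $ i $ j / 3) x"
    if "x \<noteq> 0" for x k i j
    by (rule partial_transform_within_open[of "-{0}"]) (use that A in auto)
  have pp: "partial l (partial k (\<lambda>x. A x $ i $ j)) \<omega>
      = partial l (partial k (\<lambda>x. x $ i * x $ j / (x \<bullet> x) - mat 1 $ i $ j / 3)) \<omega>" for k l i j
    by (rule partial_transform_within_open[of "-{0}"]) (use w p in auto)
  have "r\<^sup>2 * s'' r * (2/3 * (1 + 2/3 * L)) + r * s' r * (4/3 * (1 + 2/3 * L)) + s r * (-4 * (1 + 2/3 * L))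
     = r\<^sup>2 * \<psi> t (s r) * (2/3)"
    using Euler_Lagrange_on_ray[OF EL B s1 s2 eq r w(1) w(1) Aw, of 3 3]
    unfolding pp hedgehog_partial_partial[OF w(2)] p[OF w(3)] hedgehog_partial[OF w(3)] A[OF w(3)] w(2)
    by (simp add: elastic_def sum_3 mat_def \<omega>_def axis_def inner_axis_axis algebra_simps)
  then have "r\<^sup>2 * \<psi> t (s r) = (1 + 2/3 * L) * (r\<^sup>2 * s'' r + 2 * r * s' r - 6 * s r)"
    by (simp add: algebra_simps)
  then have "\<psi> t (s r) = (1 + 2/3 * L) * (r\<^sup>2 * s'' r + 2 * r * s' r - 6 * s r) / r\<^sup>2"
    using r by (simp add: eq_divide_eq mult.commute)
  then show ?thesis using r by (simp add: field_simps power2_eq_square)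
qed

section \<open>The separated solution in spherical coordinates\<close>

text \<open>At the poles, where \<open>sin \<phi> = 0\<close>, the azimuth is arbitrary and \<open>\<theta> = 0\<close> serves.\<close>

lemma spherical_onto_sphere:
  assumes "norm (x :: real^3) = 1"
  obtains \<theta> \<phi> where "\<theta> \<in> {0..<2*pi}" "\<phi> \<in> {0..pi}" "x = spherical 1 \<theta> \<phi>"
proof -
  have x: "(x $ 1)\<^sup>2 + (x $ 2)\<^sup>2 + (x $ 3)\<^sup>2 = 1"
    using assms by (simp add: norm_eq_1 inner_vec_def sum_3 power2_eq_square)
  then have "(x $ 3)\<^sup>2 \<le> 1" by (smt (verit) zero_le_power2)
  then have z: "-1 \<le> x $ 3" "x $ 3 \<le> 1" by (auto simp: abs_square_le_1 abs_le_iff)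
  define \<phi> where "\<phi> = arccos (x $ 3)"
  have ph: "\<phi> \<in> {0..pi}" "cos \<phi> = x $ 3" "sin \<phi> \<ge> 0"
    using z by (auto simp: \<phi>_def arccos_lbound arccos_ubound sin_ge_zero)
  have ss: "(sin \<phi>)\<^sup>2 = (x $ 1)\<^sup>2 + (x $ 2)\<^sup>2" using x sin_squared_eq[of \<phi>] by (simp add: ph)
  have "\<exists>\<theta>. 0 \<le> \<theta> \<and> \<theta> < 2 * pi \<and> x $ 1 = cos \<theta> * sin \<phi> \<and> x $ 2 = sin \<theta> * sin \<phi>"
  proof (cases "sin \<phi> = 0")
    case True
    then show ?thesis using ss by (intro exI[of _ 0]) (auto simp: sum_power2_eq_zero_iff)
  next
    case False
    have "(x $ 1 / sin \<phi>)\<^sup>2 + (x $ 2 / sin \<phi>)\<^sup>2 = 1"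
      using False by (simp add: power_divide add_divide_distrib[symmetric] ss[symmetric])
    then obtain \<theta> where "0 \<le> \<theta>" "\<theta> < 2 * pi" "x $ 1 / sin \<phi> = cos \<theta>" "x $ 2 / sin \<phi> = sin \<theta>"
      by (rule sincos_total_2pi)
    then show ?thesis using False by (intro exI[of _ \<theta>]) (auto simp: field_simps)
  qed
  then obtain \<theta> where "0 \<le> \<theta>" "\<theta> < 2 * pi" "x $ 1 = cos \<theta> * sin \<phi>" "x $ 2 = sin \<theta> * sin \<phi>" by blast
  then show thesis
    by (intro that[of \<theta> \<phi>]) (use ph in \<open>auto simp: vec_eq_iff forall_3 spherical_def\<close>)
qed

lemma spherical_scaleR: "spherical r \<theta> \<phi> = r *\<^sub>R spherical 1 \<theta> \<phi>"
  by (simp add: vec_eq_iff forall_3 spherical_def)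

lemma norm_spherical_1: "norm (spherical 1 \<theta> \<phi>) = 1"
proof -
  have "(cos \<theta> * sin \<phi>)\<^sup>2 + (sin \<theta> * sin \<phi>)\<^sup>2 + (cos \<phi>)\<^sup>2
      = ((cos \<theta>)\<^sup>2 + (sin \<theta>)\<^sup>2) * (sin \<phi>)\<^sup>2 + (cos \<phi>)\<^sup>2"
    by (simp only: power_mult_distrib distrib_right)
  also have "\<dots> = 1" by simp
  finally show ?thesis
    by (simp only: norm_eq_1 spherical_def inner_vec_def sum_3 power2_eq_square vector_3 inner_real_def mult_1)
qed

lemma uniaxial_tensor_nonzero:
  assumes "norm m = 1"
  shows "uniaxial_tensor 1 m \<noteq> 0"
proof
  assume "uniaxial_tensor 1 m = 0"
  then have "m $ i * m $ j - mat 1 $ i $ j / 3 = 0" for i j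
    using uniaxial_tensor_nth[of 1 m i j] by simp
  from this[of 1 1] this[of 2 2] this[of 1 2] show False by (auto simp: mat_def)
qed

theorem proposition4p1:
  fixes t L\<^sub>2 :: real
    and Q :: "real^3 \<Rightarrow> real^3^3"
    and s :: "real \<Rightarrow> real"
    and n :: "real \<Rightarrow> real \<Rightarrow> real^3"
  assumes "t \<le> 1" and "L\<^sub>2 \<noteq> 0"
    and "Euler_Lagrange_solution t L\<^sub>2 Q"
    and "uniaxial Q" and "\<not> trivial Q"
    and "\<And>\<theta> \<phi>. \<theta> \<in> {0..<2*pi} \<Longrightarrow> \<phi> \<in> {0..pi} \<Longrightarrow> norm (n \<theta> \<phi>) = 1"
    and "\<And>r \<theta> \<phi>. r \<ge> 0 \<Longrightarrow> \<theta> \<in> {0..<2*pi} \<Longrightarrow> \<phi> \<in> {0..pi} \<Longrightarrow>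
           Q (spherical r \<theta> \<phi>) = uniaxial_tensor (s r) (n \<theta> \<phi>)"
  shows "(\<forall>r>0. \<forall>\<theta>\<in>{0..<2*pi}. \<forall>\<phi>\<in>{0..pi}.
            let x = spherical r \<theta> \<phi> in n \<theta> \<phi> = x /\<^sub>R norm x \<or> n \<theta> \<phi> = - (x /\<^sub>R norm x))
         \<and> radial_solution t L\<^sub>2 s"
proof -
  note L = assms(2) and EL = assms(3) and nontrivial = assms(5) and n = assms(6) and Qn = assms(7)
  have Q_form: "Q (r *\<^sub>R spherical 1 \<theta> \<phi>) = s r *\<^sub>R uniaxial_tensor 1 (n \<theta> \<phi>)"
    if "r \<ge> 0" "\<theta> \<in> {0..<2*pi}" "\<phi> \<in> {0..pi}" for r \<theta> \<phi>
    using Qn[OF that] by (simp add: spherical_scaleR[of r] uniaxial_tensor_def)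
  have polar: "\<exists>r\<ge>0. \<exists>\<theta>\<in>{0..<2*pi}. \<exists>\<phi>\<in>{0..pi}. x = r *\<^sub>R spherical 1 \<theta> \<phi>" for x :: "real^3"
  proof (cases "x = 0")
    case True
    then show ?thesis by (intro exI[of _ 0] conjI bexI[of _ 0]) auto
  next
    case False
    then have "norm (x /\<^sub>R norm x) = 1" by simp
    then obtain \<theta> \<phi> where "\<theta> \<in> {0..<2*pi}" "\<phi> \<in> {0..pi}" "x /\<^sub>R norm x = spherical 1 \<theta> \<phi>"
      by (rule spherical_onto_sphere)
    moreover from this(3) have "x = norm x *\<^sub>R spherical 1 \<theta> \<phi>"
      using False by (simp flip: \<open>x /\<^sub>R norm x = spherical 1 \<theta> \<phi>\<close>)
    ultimately show ?thesis by (metis norm_ge_zero)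
  qed
  have range0: "(0::real) \<in> {0..<2*pi}" "(0::real) \<in> {0..pi}" by auto
  \<comment> \<open>All rays meet at the origin, so \<open>s 0 \<noteq> 0\<close> would make the director constant.\<close>
  have s0: "s 0 = 0"
  proof (rule ccontr)
    assume s0: "s 0 \<noteq> 0"
    have const: "uniaxial_tensor 1 (n \<theta> \<phi>) = uniaxial_tensor 1 (n 0 0)"
      if "\<theta> \<in> {0..<2*pi}" "\<phi> \<in> {0..pi}" for \<theta> \<phi>
      using Q_form[OF order.refl that] Q_form[OF order.refl range0] s0 by simp
    have "is_director (n 0 0) (Q x)" for x
    proof -
      obtain r \<theta> \<phi> where x: "r \<ge> 0" "\<theta> \<in> {0..<2*pi}" "\<phi> \<in> {0..pi}" "x = r *\<^sub>R spherical 1 \<theta> \<phi>"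
        using polar[of x] by blast
      have "Q x = uniaxial_tensor (s r) (n 0 0)"
        using Q_form[OF x(1-3)] const[OF x(2,3)] x(4) by (simp add: uniaxial_tensor_def)
      then show ?thesis using n[OF range0] by (auto simp: is_director_def)
    qed
    then show False using nontrivial by (auto simp: trivial_def)
  qed
  have "\<exists>\<rho>>0. s \<rho> \<noteq> 0"
  proof (rule ccontr)
    assume "\<not> ?thesis"
    then have "s r = 0" if "r \<ge> 0" for r using that s0 by (cases "r = 0") auto
    then have "Q x = 0" for x using polar[of x] Q_form by auto
    then show False using nontrivial by (auto simp: trivial_def)
  qed
  then obtain \<rho> where \<rho>: "\<rho> > 0" "s \<rho> \<noteq> 0" by blast
  define A where "A = (\<lambda>x. Q (\<rho> *\<^sub>R (x /\<^sub>R norm x)) /\<^sub>R s \<rho>)"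
  have A_spherical: "A (spherical 1 \<theta> \<phi>) = uniaxial_tensor 1 (n \<theta> \<phi>)"
    if "\<theta> \<in> {0..<2*pi}" "\<phi> \<in> {0..pi}" for \<theta> \<phi>
    using Q_form[OF less_imp_le[OF \<rho>(1)] that] \<rho> by (simp add: A_def norm_spherical_1)
  have A_scale: "A (r *\<^sub>R x) = A x" if "r > 0" for r x
  proof -
    have "(r *\<^sub>R x) /\<^sub>R norm (r *\<^sub>R x) = x /\<^sub>R norm x" using that by simp
    then show ?thesis unfolding A_def by (rule arg_cong)
  qed
  have Q_A: "Q (r *\<^sub>R x) = s (r * norm x) *\<^sub>R A x" if r: "r > 0" and "x \<noteq> 0" for r x
  proof -
    obtain r' \<theta> \<phi> where x: "r' \<ge> 0" "\<theta> \<in> {0..<2*pi}" "\<phi> \<in> {0..pi}" "x = r' *\<^sub>R spherical 1 \<theta> \<phi>"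
      using polar[of x] by blast
    with \<open>x \<noteq> 0\<close> have r': "r' > 0" by (cases "r' = 0") auto
    have "A x = uniaxial_tensor 1 (n \<theta> \<phi>)" unfolding x(4) A_scale[OF r'] by (rule A_spherical[OF x(2,3)])
    moreover have "norm x = r'" using r' by (simp add: x(4) norm_spherical_1)
    ultimately show ?thesis
      using Q_form[of "r * r'", OF _ x(2,3)] r r' by (simp add: x(4))
  qed
  have C2Q: "C2 (\<lambda>x. Q x $ i $ j)" for i j using EL by (simp add: Euler_Lagrange_solution_def)
  have regular: "twice_differentiable_off_0 (\<lambda>x. A x $ i $ j)" for i j
    using C2_radial_extension[OF C2Q[of i j], where a = "inverse (s \<rho>)" and \<rho> = \<rho>]
    unfolding A_def vector_scaleR_component real_scaleR_def .
  \<comment> \<open>The regularity of \<open>s\<close> is read off from a nonzero entry on one ray; the north pole will do.\<close>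
  define \<omega> where "\<omega> = spherical 1 0 0"
  have \<omega>: "norm \<omega> = 1" by (simp add: \<omega>_def norm_spherical_1)
  have "A \<omega> \<noteq> 0"
    using A_spherical[OF range0] uniaxial_tensor_nonzero n[OF range0] by (simp add: \<omega>_def)
  then obtain i j where a: "A \<omega> $ i $ j \<noteq> 0" by (auto simp: vec_eq_iff)
  define g where "g = (\<lambda>x. Q x $ i $ j)"
  define a where "a = A \<omega> $ i $ j"
  define s1 where "s1 = (\<lambda>r. (\<Sum>k\<in>UNIV. partial k g (r *\<^sub>R \<omega>) * \<omega> $ k) / a)"
  define s2 where "s2 = (\<lambda>r. (\<Sum>k\<in>UNIV. (\<Sum>l\<in>UNIV. partial l (partial k g) (r *\<^sub>R \<omega>) * \<omega> $ l) * \<omega> $ k) / a)"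
  have "C2 g" unfolding g_def by (rule C2Q)
  note ray = C2_ray_derivatives[OF this, of \<omega>]
  have s_ray: "s r = g (r *\<^sub>R \<omega>) / a" if "r \<ge> 0" for r
    using Q_form[OF that range0] A_spherical[OF range0] a by (simp add: g_def a_def \<omega>_def)
  have dray: "((\<lambda>r. g (r *\<^sub>R \<omega>) / a) has_real_derivative s1 r) (at r)" for r
    unfolding s1_def by (rule DERIV_cdivide[OF ray(1)])
  have d1: "(s has_real_derivative s1 r) (at r)" if "r > 0" for r
    by (rule has_field_derivative_transform_within_open[OF dray, of "{0<..}"]) (use that s_ray in auto)
  have d2: "(s1 has_real_derivative s2 r) (at r)" for r
    unfolding s1_def s2_def by (rule DERIV_cdivide[OF ray(2)])
  have c2: "continuous_on UNIV s2"
    unfolding s2_def by (intro continuous_on_divide ray(3) continuous_on_const) (use a in \<open>simp add: a_def\<close>)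
  have lim0: "(s \<longlongrightarrow> 0) (at_right 0)"
  proof -
    have "((\<lambda>r. g (r *\<^sub>R \<omega>) / a) \<longlongrightarrow> g (0 *\<^sub>R \<omega>) / a) (at_right 0)"
      using DERIV_isCont[OF dray, of 0] by (auto simp: isCont_def intro: tendsto_within_subset)
    then have "((\<lambda>r. g (r *\<^sub>R \<omega>) / a) \<longlongrightarrow> 0) (at_right 0)" using s_ray[of 0] s0 by (simp only: order.refl)
    then show ?thesis
      by (rule Lim_transform_eventually) (auto simp: eventually_at_filter s_ray intro!: always_eventually)
  qed
  have lim1: "((\<lambda>r. r * s1 r) \<longlongrightarrow> 0) (at_right 0)"
  proof -
    have "isCont (\<lambda>r. r * s1 r) 0" by (intro continuous_intros DERIV_isCont[OF d2])
    then show ?thesis by (auto simp: isCont_def intro: tendsto_within_subset)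
  qed
  have radial: "m = \<omega> \<or> m = - \<omega>" if "norm \<omega> = 1" "norm m = 1" "A \<omega> = uniaxial_tensor 1 m" for \<omega> m
    by (rule director_radial[OF EL L regular d1 d2 lim0 lim1 \<rho> Q_A that])
  have A_hedgehog: "A x $ i $ j = x $ i * x $ j / (x \<bullet> x) - mat 1 $ i $ j / 3" if "x \<noteq> 0" for x i j
  proof -
    obtain r \<theta> \<phi> where x: "r \<ge> 0" "\<theta> \<in> {0..<2*pi}" "\<phi> \<in> {0..pi}" "x = r *\<^sub>R spherical 1 \<theta> \<phi>"
      using polar[of x] by blast
    with that have r: "r > 0" by (cases "r = 0") auto
    let ?w = "spherical 1 \<theta> \<phi>"
    have "n \<theta> \<phi> = ?w \<or> n \<theta> \<phi> = - ?w"
      by (rule radial[OF norm_spherical_1 n[OF x(2,3)] A_spherical[OF x(2,3)]])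
    then have "A ?w $ i $ j = ?w $ i * ?w $ j - mat 1 $ i $ j / 3"
      unfolding A_spherical[OF x(2,3)] uniaxial_tensor_nth by auto
    moreover have "A x = A ?w" unfolding x(4) by (rule A_scale[OF r])
    moreover have "?w \<bullet> ?w = 1" using norm_spherical_1 by (simp add: norm_eq_1)
    ultimately show ?thesis using r by (simp add: x(4) power2_eq_square)
  qed
  have "radial_solution t L\<^sub>2 s"
  proof -
    have e1: "deriv s r = s1 r" if "r > 0" for r by (rule DERIV_imp_deriv[OF d1[OF that]])
    have D2: "(deriv s has_real_derivative s2 r) (at r)" if "r > 0" for r
      by (rule has_field_derivative_transform_within_open[OF d2, of "{0<..}"]) (use that e1 in auto)
    have e2: "deriv (deriv s) r = s2 r" if "r > 0" for r by (rule DERIV_imp_deriv[OF D2[OF that]])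
    have "continuous_on {0<..} (deriv (deriv s))"
      using continuous_on_subset[OF c2] e2 by (subst continuous_on_cong[OF refl, of _ _ s2]) auto
    then show ?thesis
      unfolding radial_solution_def using d1 D2 hedgehog_radial_equation[OF EL regular d1 d2 Q_A A_hedgehog]
      by (auto simp: e1 e2 real_differentiable_def)
  qed
  moreover have "let x = spherical r \<theta> \<phi> in n \<theta> \<phi> = x /\<^sub>R norm x \<or> n \<theta> \<phi> = - (x /\<^sub>R norm x)"
    if "r > 0" "\<theta> \<in> {0..<2*pi}" "\<phi> \<in> {0..pi}" for r \<theta> \<phi>
    using radial[OF norm_spherical_1 n[OF that(2,3)] A_spherical[OF that(2,3)]] that(1)
    by (simp add: spherical_scaleR[of r] norm_spherical_1)
  ultimately show ?thesis by blast
qed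

end
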